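(* Let $\lambda'_i$, $i\in\mathcal I$, be constants with $\lambda'_i\ge\lambda_i$ for all $i$ and $\lambda'_i>\lambda_i$ for at least one $i\in\mathcal I$, and consider the overloaded queueing model described in the context, with arrival rates $\lambda_i'^n$ satisfying $n^{-1}\lambda_i'^n\to\lambda_i'$. There exist constants $C_1$ and $C_2>0$ depending only on $(\lambda,\lambda',\bar\mu)$ (and not depending on $n$ or $t$) such that, under any policy, for every $t$, $$\lim_{n\to\infty}P\big(e\cdot Y^n_{OL}(t)\ge(-C_1+C_2t)n\big)=1.$$
   Context: Parameters and fluid model. Let $I,J\ge 2$, $\mathcal I=\{1,\dots,I\}$ (customer classes), $\mathcal J=\{I+1,\dots,I+J\}$ (service stations). For each $n\in\mathbb N$ there are arrival rates $\lambda_i^n>0$, service rates $\mu_{ij}^n\ge 0$ and numbers of servers $N_j^n\in\mathbb N$. The set $\mathcal E=\{(i,j)\in\mathcal I\times\mathcal J:\mu_{ij}^n>0\}$ (activities) does not depend on $n$; write $i\sim j$ if $(i,j)\in\mathcal E$. There are constants $\lambda_i,\nu_j\in(0,\infty)$, $\mu_{ij}\in(0,\infty)$ for $(i,j)\in\mathcal E$, $\mu_{ij}=0$ for $(i,j)\notin\mathcal E$, and $\hat\lambda_i,\hat\mu_{ij}\in\mathbb R$ such that $n^{-1}\lambda_i^n\to\lambda_i$, $\mu_{ij}^n\to\mu_{ij}$, $n^{-1}N_j^n\to\nu_j$, $n^{1/2}(n^{-1}\lambda_i^n-\lambda_i)\to\hat\lambda_i$, $n^{1/2}(\mu_{ij}^n-\mu_{ij})\to\hat\mu_{ij}$,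 $n^{1/2}(n^{-1}N_j^n-\nu_j)\to0$. Write $\lambda=(\lambda_i)_{i\in\mathcal I}$, $\lambda'=(\lambda_i')_{i\in\mathcal I}$, and $\bar\mu=(\bar\mu_{ij})$ with $\bar\mu_{ij}=\nu_j\mu_{ij}$. Consider the linear program: minimize $\rho\in\mathbb R_+$ subject to $\sum_{j}\bar\mu_{ij}\xi_{ij}=\lambda_i$, $\sum_i\xi_{ij}\le\rho$, $\xi_{ij}\ge0$ for all $i\in\mathcal I,j\in\mathcal J$. Standing assumption (heavy traffic): it has a unique optimal solution $(\xi^*,\rho^* )$, and $\sum_i\xi^*_{ij}=1$ for all $j\in\mathcal J$ (so $\rho^*=1$). Put $x_i^*=\sum_j\xi_{ij}^*\nu_j$. Standing assumption (complete resource pooling): the graph with vertex set $\mathcal I\cup\mathcal J$ and edge set $\{(i,j)\in\mathcal E:\xi^*_{ij}>0\}$ is a tree. Overloaded queueing model. On a complete probability space $(\Omega,\mathcal F,P)$, let $\{\check U_i(k)\}_{k\in\mathbb N}$, $i\in\mathcal I$, be independent sequences of strictly positive i.i.d. random variables with mean $1$ and finite variance, and let $A_i^n(t)=\sup\{l\ge0:\sum_{k=1}^l\check U_i(k)/\lambda_i'^n\le t\}$, where $\lambda_i'^n>0$ and $n^{-1}\lambda_i'^n\to\lambda_i'$ (so the rates $\lambda_i'^n$ replace $\lambda_i^n$). Let $S_{ij}^n$ be Poisson processes of rate $\mu_{ij}^n$ (the zero process if the rate is $0$), mutually independent and independent of the arrival processes $A_i^n$. Initial data $X^{0,n}\in\mathbb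 Z_+^I$ are deterministic and satisfy $n^{-1/2}(X_i^{0,n}-nx_i^* )\to x_i$ for some constants $x_i\in\mathbb R$. The processes $X_i^n$ (number of class-$i$ customers in the system), $Y_i^n$ (class-$i$ customers in queue), $Z_j^n$ (idle servers at station $j$), $\Psi_{ij}^n$ (class-$i$ customers in service at station $j$) have cadlag paths and satisfy, for all $t\ge 0$, $i\in\mathcal I$, $j\in\mathcal J$: (a) $\Psi_{ij}^n(t)=0$ for $i\not\sim j$; (b) $X_i^n(t)=X_i^{0,n}+A_i^n(t)-\sum_{j}S_{ij}^n\big(\int_0^t\Psi_{ij}^n(s)ds\big)$; (c) $Y_i^n(t)+\sum_j\Psi_{ij}^n(t)=X_i^n(t)$; (d) $Z_j^n(t)+\sum_i\Psi_{ij}^n(t)=N_j^n$; (e) $Y_i^n(t)\ge0$, $Z_j^n(t)\ge0$, $\Psi_{ij}^n(t)\ge0$. $Y^n_{OL}$ denotes the queue length vector $(Y_i^n)_{i\in\mathcal I}$ of this overloaded model, and $e=(1,\dots,1)'$, so $e\cdot Y^n_{OL}$ is the total number of customers in queue. Policies. "Any policy" refers to any sequence (in $n$) of control policies of one of the following two kinds. (1) Preemptive resume scheduling control policy: a map $f^n:\mathbb Z_+^I\to\mathbb Z_+^{IJ}$ such that $\Psi^n(t)=f^n(X^n(t))$ and (a)–(e) hold. (2) Nonpreemptive scheduling control policy: a triplet $(\Psi^{0,n},F^n,R^n)$ with $\Psi^n(0)=\Psi^{0,n}\in\mathbb Z_+^{IJ}$ (in particular $\Psi^{0,n}_{ij}=0$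 for $i\not\sim j$, $\sum_j\Psi^{0,n}_{ij}\le X_i^{0,n}$, $\sum_i\Psi^{0,n}_{ij}\le N_j^n$); $R^n=\{R_k^{n,i}:k\in\mathbb N,i\in\mathcal I\}$ independent real random variables, independent of $A^n,S^n$; $F^n$ a collection of measurable maps $F_{ij}^n:\mathbb R_+\times\mathbb Z_+^I\times\mathbb Z_+^I\times\mathbb Z_+^J\times\mathbb Z_+^{IJ}\times\mathbb R\to\mathbb Z_+$; such that (a)–(e) hold together with $\Psi_{ij}^n(t)=\Psi_{ij}^n(0)+B_{ij}^n(t)-S_{ij}^n(\int_0^t\Psi_{ij}^n(s)ds)$, where $B_{ij}^n(t)=\sum_{k:\tau_k^{n,i}\le t}F_{ij}^n(\tau_k^{n,i},\Xi^n(\tau_k^{n,i}-),R_k^{n,i})$ (with $B_{ij}^n=0$ for $i\not\sim j$), $\tau_k^{n,i}$ is the $k$th jump time of $A_i^n$ and $\Xi^n=(X^n,Y^n,Z^n,\Psi^n)$.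
   Formalization: C_1 is allowed to depend also on the limiting station sizes ν (hence μ), while C_2 depends only on (λ,λ',μ̄); with C_1 independent of ν the claim fails, since for ν=(K,K) with K large and μ̄ fixed, a policy can keep the queue o(n) on a time interval of order K. *)

theory Defs
  imports "HOL-Probability.Probability"
begin

text \<open>
  Customer classes are the elements of a finite type \<open>'i\<close>, service stations those of a finite
  type \<open>'j\<close>.  Numbers of customers and servers have type \<^typ>\<open>nat\<close>, so nonnegativity and
  integrality of the state processes are part of their types.
\<close>

section \<open>The static fluid model\<close>

definition lp_feasible ::
    "('i::finite \<Rightarrow> real) \<Rightarrow> ('i \<Rightarrow> 'j::finite \<Rightarrow> real) \<Rightarrow> ('i \<Rightarrow> 'j \<Rightarrow> real) \<Rightarrow> real \<Rightarrow> bool" where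
  "lp_feasible lam mubar xi rho \<longleftrightarrow>
     0 \<le> rho \<and>
     (\<forall>i. (\<Sum>j\<in>UNIV. mubar i j * xi i j) = lam i) \<and>
     (\<forall>j. (\<Sum>i\<in>UNIV. xi i j) \<le> rho) \<and>
     (\<forall>i j. 0 \<le> xi i j)"

definition lp_optimal ::
    "('i::finite \<Rightarrow> real) \<Rightarrow> ('i \<Rightarrow> 'j::finite \<Rightarrow> real) \<Rightarrow> ('i \<Rightarrow> 'j \<Rightarrow> real) \<Rightarrow> real \<Rightarrow> bool" where
  "lp_optimal lam mubar xi rho \<longleftrightarrow>
     lp_feasible lam mubar xi rho \<and>
     (\<forall>xi' rho'. lp_feasible lam mubar xi' rho' \<longrightarrow> rho \<le> rho')"

definition heavy_traffic ::
    "('i::finite \<Rightarrow> real) \<Rightarrow> ('i \<Rightarrow> 'j::finite \<Rightarrow> real) \<Rightarrow> ('i \<Rightarrow> 'j \<Rightarrow> real) \<Rightarrow> real \<Rightarrow> bool" where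
  "heavy_traffic lam mubar xi rho \<longleftrightarrow>
     lp_optimal lam mubar xi rho \<and>
     (\<forall>xi' rho'. lp_optimal lam mubar xi' rho' \<longrightarrow> xi' = xi \<and> rho' = rho) \<and>
     (\<forall>j. (\<Sum>i\<in>UNIV. xi i j) = 1)"

text \<open>
  Simple undirected graphs are given by a vertex set and a set of two-element edges.  (The notion
  of tree in the AFP entry \<open>Graph_Theory\<close> only excludes directed cycles and is therefore not the
  one needed here.)
\<close>

definition graph_connected :: "'v set \<Rightarrow> 'v set set \<Rightarrow> bool" where
  "graph_connected V E \<longleftrightarrow> V \<noteq> {} \<and> (\<forall>u\<in>V. \<forall>v\<in>V. (u, v) \<in> {(a, b). {a, b} \<in> E}\<^sup>*)"

definition graph_cycle :: "'v set set \<Rightarrow> 'v list \<Rightarrow> bool" where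
  "graph_cycle E vs \<longleftrightarrow>
     3 \<le> length vs \<and> distinct vs \<and>
     (\<forall>k<length vs. {vs ! k, vs ! (Suc k mod length vs)} \<in> E)"

definition graph_tree :: "'v set \<Rightarrow> 'v set set \<Rightarrow> bool" where
  "graph_tree V E \<longleftrightarrow> graph_connected V E \<and> (\<nexists>vs. graph_cycle E vs)"

text \<open>
  Activities are the pairs with a positive service rate; \<open>mubar i j > 0\<close> is equivalent to
  \<open>mu i j > 0\<close>, as \<open>mubar i j = nu j * mu i j\<close> with \<open>nu j > 0\<close>.
\<close>

definition complete_resource_pooling ::
    "('i \<Rightarrow> 'j \<Rightarrow> real) \<Rightarrow> ('i \<Rightarrow> 'j \<Rightarrow> real) \<Rightarrow> bool" where
  "complete_resource_pooling mubar xi \<longleftrightarrow>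
     graph_tree (UNIV :: ('i + 'j) set) {{Inl i, Inr j} | i j. 0 < mubar i j \<and> 0 < xi i j}"

section \<open>Sequences of parameters\<close>

text \<open>
  The system index \<open>n\<close> ranges over the positive integers throughout.
\<close>

definition parameter_limits ::
    "('i \<Rightarrow> real) \<Rightarrow> ('i \<Rightarrow> 'j \<Rightarrow> real) \<Rightarrow> ('j \<Rightarrow> real) \<Rightarrow>
     (nat \<Rightarrow> 'i \<Rightarrow> real) \<Rightarrow> (nat \<Rightarrow> 'i \<Rightarrow> 'j \<Rightarrow> real) \<Rightarrow> (nat \<Rightarrow> 'j \<Rightarrow> nat) \<Rightarrow> bool" where
  "parameter_limits lam mu nu lamN muN NN \<longleftrightarrow>
     (\<forall>n>0. \<forall>i. 0 < lamN n i) \<and>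
     (\<forall>n>0. \<forall>i j. 0 \<le> muN n i j \<and> (0 < muN n i j \<longleftrightarrow> 0 < mu i j)) \<and>
     (\<forall>i. (\<lambda>n. lamN n i / real n) \<longlonglongrightarrow> lam i) \<and>
     (\<forall>i j. (\<lambda>n. muN n i j) \<longlonglongrightarrow> mu i j) \<and>
     (\<forall>j. (\<lambda>n. real (NN n j) / real n) \<longlonglongrightarrow> nu j) \<and>
     (\<exists>lamhat. \<forall>i. (\<lambda>n. sqrt (real n) * (lamN n i / real n - lam i)) \<longlonglongrightarrow> lamhat i) \<and>
     (\<exists>muhat. \<forall>i j. (\<lambda>n. sqrt (real n) * (muN n i j - mu i j)) \<longlonglongrightarrow> muhat i j) \<and>
     (\<forall>j. (\<lambda>n. sqrt (real n) * (real (NN n j) / real n - nu j)) \<longlonglongrightarrow> 0)"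

definition overload_limits ::
    "('i \<Rightarrow> real) \<Rightarrow> (nat \<Rightarrow> 'i \<Rightarrow> real) \<Rightarrow> bool" where
  "overload_limits lam' lamN' \<longleftrightarrow>
     (\<forall>n>0. \<forall>i. 0 < lamN' n i) \<and> (\<forall>i. (\<lambda>n. lamN' n i / real n) \<longlonglongrightarrow> lam' i)"

definition fluid_state :: "('i \<Rightarrow> 'j::finite \<Rightarrow> real) \<Rightarrow> ('j \<Rightarrow> real) \<Rightarrow> 'i \<Rightarrow> real" where
  "fluid_state xi nu i = (\<Sum>j\<in>UNIV. xi i j * nu j)"

definition initial_limits ::
    "('i \<Rightarrow> 'j::finite \<Rightarrow> real) \<Rightarrow> ('j \<Rightarrow> real) \<Rightarrow> (nat \<Rightarrow> 'i \<Rightarrow> nat) \<Rightarrow> bool" where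
  "initial_limits xi nu X0 \<longleftrightarrow>
     (\<exists>x. \<forall>i. (\<lambda>n. (real (X0 n i) - real n * fluid_state xi nu i) / sqrt (real n)) \<longlonglongrightarrow> x i)"

section \<open>Primitive processes\<close>

definition cadlag :: "(real \<Rightarrow> 'a::topological_space) \<Rightarrow> bool" where
  "cadlag f \<longleftrightarrow>
     (\<forall>t\<ge>0. (f \<longlongrightarrow> f t) (at_right t)) \<and> (\<forall>t>0. \<exists>l. (f \<longlongrightarrow> l) (at_left t))"

text \<open>The interarrival sequences are indexed by \<open>k \<ge> 1\<close>.\<close>

definition interarrival_sequences :: "'w measure \<Rightarrow> ('i \<Rightarrow> nat \<Rightarrow> 'w \<Rightarrow> real) \<Rightarrow> bool" where
  "interarrival_sequences M U \<longleftrightarrow>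
     prob_space.indep_vars M (\<lambda>_. borel) (\<lambda>(i, k). U i k) (UNIV \<times> {1..}) \<and>
     (\<forall>i. \<forall>k\<ge>1.
        distr M borel (U i k) = distr M borel (U i 1) \<and>
        (AE \<omega> in M. 0 < U i k \<omega>) \<and>
        integrable M (U i k) \<and> prob_space.expectation M (U i k) = 1 \<and>
        integrable M (\<lambda>\<omega>. (U i k \<omega>)\<^sup>2))"

text \<open>
  Almost surely the set below is finite and contains \<open>0\<close>; on \<^typ>\<open>nat\<close>, the supremum of an
  infinite set is an irrelevant default value.
\<close>

definition arrivals ::
    "('i \<Rightarrow> nat \<Rightarrow> 'w \<Rightarrow> real) \<Rightarrow> ('i \<Rightarrow> real) \<Rightarrow> 'i \<Rightarrow> real \<Rightarrow> 'w \<Rightarrow> nat" where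
  "arrivals U rate i t \<omega> = Sup {l. (\<Sum>k=1..l. U i k \<omega> / rate i) \<le> t}"

definition poisson_process :: "'w measure \<Rightarrow> real \<Rightarrow> (real \<Rightarrow> 'w \<Rightarrow> nat) \<Rightarrow> bool" where
  "poisson_process M r S \<longleftrightarrow>
     0 < r \<and>
     (\<forall>t\<ge>0. S t \<in> M \<rightarrow>\<^sub>M count_space UNIV) \<and>
     (AE \<omega> in M. S 0 \<omega> = 0 \<and> mono_on {0..} (\<lambda>t. S t \<omega>) \<and> cadlag (\<lambda>t. S t \<omega>)) \<and>
     (\<forall>s t. 0 \<le> s \<longrightarrow> s < t \<longrightarrow>
        distr M (count_space UNIV) (\<lambda>\<omega>. S t \<omega> - S s \<omega>) = measure_pmf (poisson_pmf (r * (t - s)))) \<and>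
     (\<forall>(ts :: nat \<Rightarrow> real) m. 0 \<le> ts 0 \<longrightarrow> mono ts \<longrightarrow>
        prob_space.indep_vars M (\<lambda>_. count_space UNIV)
          (\<lambda>k \<omega>. S (ts (Suc k)) \<omega> - S (ts k) \<omega>) {..<m})"

definition service_process :: "'w measure \<Rightarrow> real \<Rightarrow> (real \<Rightarrow> 'w \<Rightarrow> nat) \<Rightarrow> bool" where
  "service_process M r S \<longleftrightarrow>
     (if r = 0 then AE \<omega> in M. \<forall>t\<ge>0. S t \<omega> = 0 else poisson_process M r S)"

text \<open>The family of all arrival and potential service processes of one system.\<close>

definition primitives ::
    "('i \<Rightarrow> real \<Rightarrow> 'w \<Rightarrow> nat) \<Rightarrow> ('i \<Rightarrow> 'j \<Rightarrow> real \<Rightarrow> 'w \<Rightarrow> nat) \<Rightarrow>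
     'i + 'i \<times> 'j \<Rightarrow> real \<Rightarrow> 'w \<Rightarrow> nat" where
  "primitives A S p = (case p of Inl i \<Rightarrow> A i | Inr (i, j) \<Rightarrow> S i j)"

definition primitive_processes ::
    "'w measure \<Rightarrow> ('i \<Rightarrow> 'j \<Rightarrow> real) \<Rightarrow> ('i \<Rightarrow> real \<Rightarrow> 'w \<Rightarrow> nat) \<Rightarrow>
     ('i \<Rightarrow> 'j \<Rightarrow> real \<Rightarrow> 'w \<Rightarrow> nat) \<Rightarrow> bool" where
  "primitive_processes M rate A S \<longleftrightarrow>
     (\<forall>i j. service_process M (rate i j) (S i j)) \<and>
     prob_space.indep_vars M (\<lambda>_. PiM {0..} (\<lambda>_. count_space UNIV))
       (\<lambda>p \<omega>. \<lambda>t\<in>{0..}. primitives A S p t \<omega>) UNIV"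

section \<open>The queueing model and its control policies\<close>

text \<open>
  The definitions of this section concern a single system (fixed \<open>n\<close>).  \<open>X\<close>, \<open>Y\<close>, \<open>Z\<close>, \<open>Psi\<close> are
  the numbers of customers in the system, customers in queue, idle servers and customers in
  service.  Identities between paths are required almost surely, for all times simultaneously.
\<close>

definition busy_time :: "('i \<Rightarrow> 'j \<Rightarrow> real \<Rightarrow> 'w \<Rightarrow> nat) \<Rightarrow> 'i \<Rightarrow> 'j \<Rightarrow> real \<Rightarrow> 'w \<Rightarrow> real" where
  "busy_time Psi i j t \<omega> = integral {0..t} (\<lambda>s. real (Psi i j s \<omega>))"

definition queueing_model ::
    "'w measure \<Rightarrow> ('i::finite \<Rightarrow> 'j::finite \<Rightarrow> real) \<Rightarrow> ('j \<Rightarrow> nat) \<Rightarrow> ('i \<Rightarrow> nat) \<Rightarrow>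
     ('i \<Rightarrow> real \<Rightarrow> 'w \<Rightarrow> nat) \<Rightarrow> ('i \<Rightarrow> 'j \<Rightarrow> real \<Rightarrow> 'w \<Rightarrow> nat) \<Rightarrow>
     ('i \<Rightarrow> real \<Rightarrow> 'w \<Rightarrow> nat) \<Rightarrow> ('i \<Rightarrow> real \<Rightarrow> 'w \<Rightarrow> nat) \<Rightarrow>
     ('j \<Rightarrow> real \<Rightarrow> 'w \<Rightarrow> nat) \<Rightarrow> ('i \<Rightarrow> 'j \<Rightarrow> real \<Rightarrow> 'w \<Rightarrow> nat) \<Rightarrow> bool" where
  "queueing_model M mu N X0 A S X Y Z Psi \<longleftrightarrow>
     (\<forall>t\<ge>0. \<forall>i j.
        X i t \<in> M \<rightarrow>\<^sub>M count_space UNIV \<and> Y i t \<in> M \<rightarrow>\<^sub>M count_space UNIV \<and>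
        Z j t \<in> M \<rightarrow>\<^sub>M count_space UNIV \<and> Psi i j t \<in> M \<rightarrow>\<^sub>M count_space UNIV) \<and>
     (AE \<omega> in M. \<forall>i j.
        cadlag (\<lambda>t. X i t \<omega>) \<and> cadlag (\<lambda>t. Y i t \<omega>) \<and>
        cadlag (\<lambda>t. Z j t \<omega>) \<and> cadlag (\<lambda>t. Psi i j t \<omega>)) \<and>
     (AE \<omega> in M. \<forall>t\<ge>0. \<forall>i j.
        (\<not> 0 < mu i j \<longrightarrow> Psi i j t \<omega> = 0) \<and>
        real (X i t \<omega>) = real (X0 i) + real (A i t \<omega>)
          - (\<Sum>j\<in>UNIV. real (S i j (busy_time Psi i j t \<omega>) \<omega>)) \<and>
        Y i t \<omega> + (\<Sum>j\<in>UNIV. Psi i j t \<omega>) = X i t \<omega> \<and>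
        Z j t \<omega> + (\<Sum>i\<in>UNIV. Psi i j t \<omega>) = N j)"

definition preemptive_policy ::
    "'w measure \<Rightarrow> ('i \<Rightarrow> real \<Rightarrow> 'w \<Rightarrow> nat) \<Rightarrow> ('i \<Rightarrow> 'j \<Rightarrow> real \<Rightarrow> 'w \<Rightarrow> nat) \<Rightarrow> bool" where
  "preemptive_policy M X Psi \<longleftrightarrow>
     (\<exists>f :: ('i \<Rightarrow> nat) \<Rightarrow> 'i \<Rightarrow> 'j \<Rightarrow> nat.
        AE \<omega> in M. \<forall>t\<ge>0. \<forall>i j. Psi i j t \<omega> = f (\<lambda>i. X i t \<omega>) i j)"

text \<open>
  The \<open>k\<close>-th jump time (\<open>k \<ge> 1\<close>) of a counting path with unit jumps.  As the interarrival times
  are almost surely positive, the paths of the arrival processes are of this kind.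
\<close>

definition jump_time :: "(real \<Rightarrow> nat) \<Rightarrow> nat \<Rightarrow> real" where
  "jump_time a k = Inf {t. 0 \<le> t \<and> k \<le> a t}"

definition left_limit :: "(real \<Rightarrow> 'a::t2_space) \<Rightarrow> real \<Rightarrow> 'a" where
  "left_limit f t = Lim (at_left t) f"

definition routing ::
    "('i \<Rightarrow> 'j \<Rightarrow>
       real \<times> ('i \<Rightarrow> nat) \<times> ('i \<Rightarrow> nat) \<times> ('j \<Rightarrow> nat) \<times> ('i \<Rightarrow> 'j \<Rightarrow> nat) \<times> real \<Rightarrow> nat) \<Rightarrow>
     (nat \<Rightarrow> 'i \<Rightarrow> 'w \<Rightarrow> real) \<Rightarrow> ('i \<Rightarrow> real \<Rightarrow> 'w \<Rightarrow> nat) \<Rightarrow>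
     ('i \<Rightarrow> real \<Rightarrow> 'w \<Rightarrow> nat) \<Rightarrow> ('i \<Rightarrow> real \<Rightarrow> 'w \<Rightarrow> nat) \<Rightarrow>
     ('j \<Rightarrow> real \<Rightarrow> 'w \<Rightarrow> nat) \<Rightarrow> ('i \<Rightarrow> 'j \<Rightarrow> real \<Rightarrow> 'w \<Rightarrow> nat) \<Rightarrow>
     'i \<Rightarrow> 'j \<Rightarrow> real \<Rightarrow> 'w \<Rightarrow> nat" where
  "routing F R A X Y Z Psi i j t \<omega> =
     (\<Sum>k | 1 \<le> k \<and> jump_time (\<lambda>t. A i t \<omega>) k \<le> t.
        let s = jump_time (\<lambda>t. A i t \<omega>) k in
        F i j (s,
          (\<lambda>i. left_limit (\<lambda>t. X i t \<omega>) s),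
          (\<lambda>i. left_limit (\<lambda>t. Y i t \<omega>) s),
          (\<lambda>j. left_limit (\<lambda>t. Z j t \<omega>) s),
          (\<lambda>i j. left_limit (\<lambda>t. Psi i j t \<omega>) s),
          R k i \<omega>))"

text \<open>
  The types of the discrete state components are countable, hence carry the discrete
  sigma-algebra.
\<close>

definition nonpreemptive_policy ::
    "'w measure \<Rightarrow> ('i::finite \<Rightarrow> 'j::finite \<Rightarrow> real) \<Rightarrow> ('j \<Rightarrow> nat) \<Rightarrow> ('i \<Rightarrow> nat) \<Rightarrow>
     ('i \<Rightarrow> real \<Rightarrow> 'w \<Rightarrow> nat) \<Rightarrow> ('i \<Rightarrow> 'j \<Rightarrow> real \<Rightarrow> 'w \<Rightarrow> nat) \<Rightarrow>
     ('i \<Rightarrow> real \<Rightarrow> 'w \<Rightarrow> nat) \<Rightarrow> ('i \<Rightarrow> real \<Rightarrow> 'w \<Rightarrow> nat) \<Rightarrow>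
     ('j \<Rightarrow> real \<Rightarrow> 'w \<Rightarrow> nat) \<Rightarrow> ('i \<Rightarrow> 'j \<Rightarrow> real \<Rightarrow> 'w \<Rightarrow> nat) \<Rightarrow> bool" where
  "nonpreemptive_policy M mu N X0 A S X Y Z Psi \<longleftrightarrow>
     (\<exists>(Psi0 :: 'i \<Rightarrow> 'j \<Rightarrow> nat) F (R :: nat \<Rightarrow> 'i \<Rightarrow> 'w \<Rightarrow> real).
        (\<forall>i j. \<not> 0 < mu i j \<longrightarrow> Psi0 i j = 0) \<and>
        (\<forall>i. (\<Sum>j\<in>UNIV. Psi0 i j) \<le> X0 i) \<and>
        (\<forall>j. (\<Sum>i\<in>UNIV. Psi0 i j) \<le> N j) \<and>
        (\<forall>i j. F i j \<in>
           (restrict_space borel {0..} \<Otimes>\<^sub>M count_space UNIV \<Otimes>\<^sub>M count_space UNIV \<Otimes>\<^sub>M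
            count_space UNIV \<Otimes>\<^sub>M count_space UNIV \<Otimes>\<^sub>M borel) \<rightarrow>\<^sub>M count_space UNIV) \<and>
        prob_space.indep_vars M (\<lambda>_. borel) (\<lambda>(k, i). R k i) ({1..} \<times> UNIV) \<and>
        prob_space.indep_set M
          (sets (vimage_algebra (space M)
             (\<lambda>\<omega>. \<lambda>(k, i)\<in>{1..} \<times> UNIV. R k i \<omega>) (PiM ({1..} \<times> UNIV) (\<lambda>_. borel))))
          (sets (vimage_algebra (space M)
             (\<lambda>\<omega>. \<lambda>(p, t)\<in>UNIV \<times> {0..}. primitives A S p t \<omega>)
             (PiM (UNIV \<times> {0..}) (\<lambda>_. count_space UNIV)))) \<and>
        (AE \<omega> in M. \<forall>i j. Psi i j 0 \<omega> = Psi0 i j) \<and>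
        (AE \<omega> in M. \<forall>t\<ge>0. \<forall>i j.
           (\<not> 0 < mu i j \<longrightarrow> routing F R A X Y Z Psi i j t \<omega> = 0) \<and>
           real (Psi i j t \<omega>) = real (Psi i j 0 \<omega>) + real (routing F R A X Y Z Psi i j t \<omega>)
             - real (S i j (busy_time Psi i j t \<omega>) \<omega>)))"

text \<open>
  The overloaded model under a sequence of policies, each of which may be of either kind.
\<close>

definition controlled_overloaded_model ::
    "'w measure \<Rightarrow> (nat \<Rightarrow> 'i::finite \<Rightarrow> real) \<Rightarrow> (nat \<Rightarrow> 'i \<Rightarrow> 'j::finite \<Rightarrow> real) \<Rightarrow>
     (nat \<Rightarrow> 'j \<Rightarrow> nat) \<Rightarrow> (nat \<Rightarrow> 'i \<Rightarrow> nat) \<Rightarrow> ('i \<Rightarrow> nat \<Rightarrow> 'w \<Rightarrow> real) \<Rightarrow>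
     (nat \<Rightarrow> 'i \<Rightarrow> 'j \<Rightarrow> real \<Rightarrow> 'w \<Rightarrow> nat) \<Rightarrow>
     (nat \<Rightarrow> 'i \<Rightarrow> real \<Rightarrow> 'w \<Rightarrow> nat) \<Rightarrow> (nat \<Rightarrow> 'i \<Rightarrow> real \<Rightarrow> 'w \<Rightarrow> nat) \<Rightarrow>
     (nat \<Rightarrow> 'j \<Rightarrow> real \<Rightarrow> 'w \<Rightarrow> nat) \<Rightarrow> (nat \<Rightarrow> 'i \<Rightarrow> 'j \<Rightarrow> real \<Rightarrow> 'w \<Rightarrow> nat) \<Rightarrow> bool" where
  "controlled_overloaded_model M lamN' muN NN X0 U S X Y Z Psi \<longleftrightarrow>
     interarrival_sequences M U \<and>
     (\<forall>n>0.
        let A = arrivals U (lamN' n) in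
        primitive_processes M (muN n) A (S n) \<and>
        queueing_model M (muN n) (NN n) (X0 n) A (S n) (X n) (Y n) (Z n) (Psi n) \<and>
        (preemptive_policy M (X n) (Psi n) \<or>
         nonpreemptive_policy M (muN n) (NN n) (X0 n) A (S n) (X n) (Y n) (Z n) (Psi n)))"

end

theory Submission
  imports Defs "HOL-Real_Asymp.Real_Asymp"
begin

text \<open>
  The idea is to price the work of each class by the dual of the static linear program.  Duality
  yields prices \<open>a i\<close> of customers and values \<open>z j\<close> of stations with \<open>a i * mubar i j \<le> z j\<close> and
  \<open>(\<Sum>j. z j) = (\<Sum>i. a i * lam i)\<close>.  The first condition bounds the rate at which a fully occupied
  station \<open>j\<close> can remove priced work by \<open>n * z j\<close>, whichever classes it serves; the second one
  says that at arrival rates \<open>n * lam i\<close> the priced inflow equals this maximal outflow.  Hence, at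
  the larger rates \<open>n * lam' i\<close>, the workload \<open>W = (\<Sum>i. a i * X i)\<close> grows under any policy at least
  at rate \<open>n * g\<close> with \<open>g = (\<Sum>i. a i * (lam' i - lam i))\<close>.  Complete resource pooling
  forces all \<open>a i\<close> to be strictly positive, so that \<open>g > 0\<close>
  (\<open>workload_prices_positive\<close>).  Since \<open>W\<close> is at most \<open>(\<Sum>i. a i)\<close> times the number of customers, of whom
  no more than \<open>\<Sum>j. N j\<close> are in service, the total queue grows at least linearly, with slope
  \<open>C2 = g / (\<Sum>i. a i)\<close>, which depends on \<open>lam\<close>, \<open>lam'\<close> and \<open>mubar\<close> alone.

  For a fixed time \<open>t\<close> this fluid argument survives the passage to the stochastic system because
  only one-sided estimates of order \<open>n\<close> are needed, each valid with probability tending to \<open>1\<close>: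
  the arrivals up to time \<open>t\<close> are at least \<open>(lam' i * t - e) * n\<close>, by Chebyshev's inequality for
  the sum of the interarrival times (\<open>arrivals_lower_bound\<close>), and the service processes exceed
  their mean by at most \<open>e * n\<close> on the whole interval \<open>{0..K * n}\<close>, which contains all busy times
  (\<open>service_process_bound_uniform\<close>).  Uniformity in the argument is what makes the estimate
  applicable to the random busy times, however the policy couples them with the primitive
  processes.  The errors add up to a bounded multiple of \<open>e * n\<close>; with
  \<open>e\<close> chosen small depending on \<open>t\<close> they cost at most \<open>n\<close> units of workload and are absorbed by
  \<open>C1\<close>.  The pathwise bookkeeping is \<open>queue_lower_bound\<close>.
\<close>

section \<open>Dual prices of the static linear program\<close>

text \<open>
  The prices are the normal vector of a separating hyperplane.  The output
  rate vectors of allocations with station loads at most \<open>1\<close> form a convex set.  Because the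
  optimal load is \<open>1\<close>, this set misses the ray \<open>{s * lam | s > 1}\<close>, and \<open>lam\<close> maximizes the
  separating functional \<open>a\<close> on it.  The value \<open>z j\<close> is what column \<open>j\<close> of \<open>xi\<close> contributes to this
  maximum.  The columns can be varied independently, so \<open>z j\<close> is also the maximum over all
  columns: unit columns give \<open>a i * mubar i j \<le> z j\<close>, the zero column gives \<open>0 \<le> z j\<close>, and
  since \<open>z j\<close> is the average of \<open>a i * mubar i j\<close> with weights \<open>xi i j\<close>, equality holds where
  the weight is positive (complementary slackness).
\<close>

lemma workload_prices:
  fixes lam :: "'i::finite \<Rightarrow> real" and mubar xi :: "'i \<Rightarrow> 'j::finite \<Rightarrow> real"
  assumes ht: "heavy_traffic lam mubar xi rho"
  shows "\<exists>a z. (\<exists>i. a i \<noteq> 0) \<and> (\<forall>j. 0 \<le> z j) \<and>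
    (\<forall>i j. a i * mubar i j \<le> z j) \<and>
    (\<forall>i j. 0 < xi i j \<longrightarrow> a i * mubar i j = z j) \<and>
    (\<Sum>j\<in>UNIV. z j) = (\<Sum>i\<in>UNIV. a i * lam i)"
proof -
  have load1: "(\<Sum>i\<in>UNIV. xi i j) = 1" for j
    using ht unfolding heavy_traffic_def by blast
  have opt: "lp_optimal lam mubar xi rho"
    using ht unfolding heavy_traffic_def by blast
  have rates: "(\<Sum>j\<in>UNIV. mubar i j * xi i j) = lam i" for i
    using opt unfolding lp_optimal_def lp_feasible_def by blast
  have xi0: "0 \<le> xi i j" for i j
    using opt unfolding lp_optimal_def lp_feasible_def by blast
  have "1 \<le> rho"
    using opt load1 unfolding lp_optimal_def lp_feasible_def by metis
  define alloc where "alloc = {x :: 'i \<Rightarrow> 'j \<Rightarrow> real. (\<forall>i j. 0 \<le> x i j) \<and> (\<forall>j. (\<Sum>i\<in>UNIV. x i j) \<le> 1)}"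
  define out :: "('i \<Rightarrow> 'j \<Rightarrow> real) \<Rightarrow> real^'i" where "out x = (\<chi> i. \<Sum>j\<in>UNIV. mubar i j * x i j)" for x
  define L :: "real^'i" where "L = (\<chi> i. lam i)"
  have xi_alloc: "xi \<in> alloc"
    using xi0 load1 by (simp add: alloc_def)
  have conv: "convex (out ` alloc)"
  proof (rule convexI)
    fix v w :: "real^'i" and p q :: real
    assume vw: "v \<in> out ` alloc" "w \<in> out ` alloc" and pq: "0 \<le> p" "0 \<le> q" "p + q = 1"
    obtain x y where x: "x \<in> alloc" "v = out x" and y: "y \<in> alloc" "w = out y" using vw by blast
    let ?m = "\<lambda>i j. p * x i j + q * y i j"
    have "(\<Sum>i\<in>UNIV. ?m i j) \<le> 1" for j
    proof -
      have "(\<Sum>i\<in>UNIV. ?m i j) = p * (\<Sum>i\<in>UNIV. x i j) + q * (\<Sum>i\<in>UNIV. y i j)"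
        by (simp add: sum.distrib sum_distrib_left)
      also have "\<dots> \<le> p * 1 + q * 1"
        using x y pq by (intro add_mono mult_left_mono) (auto simp: alloc_def)
      finally show ?thesis using pq by simp
    qed
    then have "?m \<in> alloc"
      using x y pq by (auto simp: alloc_def)
    moreover have "p *\<^sub>R v + q *\<^sub>R w = out ?m"
      by (simp add: x y out_def vec_eq_iff sum_distrib_left sum.distrib algebra_simps)
    ultimately show "p *\<^sub>R v + q *\<^sub>R w \<in> out ` alloc" by blast
  qed
  have conv_ray: "convex ((\<lambda>s. s *\<^sub>R L) ` {1<..})"
    by (intro convex_linear_image linear_scale_left convex_real_interval)
  \<comment> \<open>A point of the ray would serve \<open>lam\<close> with load \<open>1 / s\<close>, below the optimum.\<close>
  have disj: "out ` alloc \<inter> (\<lambda>s. s *\<^sub>R L) ` {1<..} = {}"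
  proof (rule ccontr)
    assume "\<not> ?thesis"
    then obtain x s where x: "x \<in> alloc" and s: "1 < s" and eq: "out x = s *\<^sub>R L" by auto
    have "lp_feasible lam mubar (\<lambda>i j. x i j / s) (1 / s)"
      unfolding lp_feasible_def
    proof (intro conjI allI)
      fix i
      have "(\<Sum>j\<in>UNIV. mubar i j * x i j) = s * lam i"
        using eq by (simp add: out_def L_def vec_eq_iff)
      then show "(\<Sum>j\<in>UNIV. mubar i j * (x i j / s)) = lam i"
        using s by (simp add: sum_divide_distrib[symmetric])
    next
      fix j
      show "(\<Sum>i\<in>UNIV. x i j / s) \<le> 1 / s"
        using x s by (simp add: sum_divide_distrib[symmetric] alloc_def divide_right_mono)
    qed (use x s in \<open>auto simp: alloc_def\<close>)
    then have "rho \<le> 1 / s" using opt unfolding lp_optimal_def by blast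
    moreover have "1 / s < 1" using s by simp
    ultimately show False using \<open>1 \<le> rho\<close> by linarith
  qed
  obtain A b where A: "A \<noteq> 0" "\<And>x. x \<in> alloc \<Longrightarrow> A \<bullet> out x \<le> b"
      "\<And>s. 1 < s \<Longrightarrow> b \<le> A \<bullet> (s *\<^sub>R L)"
  proof -
    have "out ` alloc \<noteq> {}" "(\<lambda>s. s *\<^sub>R L) ` {1<..} \<noteq> {}" using xi_alloc by auto
    then obtain A b where "A \<noteq> 0" "\<forall>x\<in>out ` alloc. A \<bullet> x \<le> b"
        "\<forall>x\<in>(\<lambda>s. s *\<^sub>R L) ` {1<..}. b \<le> A \<bullet> x"
      using separating_hyperplane_sets[OF conv conv_ray _ _ disj] by metis
    then show thesis using that[of A b] by blast
  qed
  \<comment> \<open>Let \<open>s\<close> decrease to \<open>1\<close>.\<close>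
  have LA: "A \<bullet> L \<ge> b"
  proof (rule tendsto_lowerbound)
    have "((\<lambda>s. A \<bullet> (s *\<^sub>R L)) \<longlongrightarrow> A \<bullet> (1 *\<^sub>R L)) (at_right 1)"
      by (intro tendsto_intros)
    then show "((\<lambda>s. A \<bullet> (s *\<^sub>R L)) \<longlongrightarrow> A \<bullet> L) (at_right 1)" by simp
    show "\<forall>\<^sub>F s in at_right 1. b \<le> A \<bullet> (s *\<^sub>R L)"
      using A(3) by (auto simp: eventually_at_right_field intro: exI[of _ 2])
  qed simp
  define a where "a i = A $ i" for i
  have val: "A \<bullet> out x = (\<Sum>j\<in>UNIV. \<Sum>i\<in>UNIV. a i * mubar i j * x i j)" for x
    by (simp add: inner_vec_def out_def a_def sum_distrib_left mult.assoc)
       (rule sum.swap)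
  have "out xi = L" by (simp add: out_def L_def rates)
  define z where "z j = (\<Sum>i\<in>UNIV. a i * mubar i j * xi i j)" for j
  have sum_z: "(\<Sum>j\<in>UNIV. z j) = A \<bullet> L"
    using val[of xi] \<open>out xi = L\<close> by (simp add: z_def)
  have column: "(\<Sum>i\<in>UNIV. a i * mubar i j * c i) \<le> z j"
    if c: "\<And>i. 0 \<le> c i" "(\<Sum>i\<in>UNIV. c i) \<le> 1" for c j
  proof -
    \<comment> \<open>Exchange column \<open>j\<close> of the optimal allocation for \<open>c\<close>.\<close>
    define x where "x = (\<lambda>i k. if k = j then c i else xi i k)"
    have "(\<Sum>i\<in>UNIV. x i k) \<le> 1" for k
      using c(2) load1[of k] by (cases "k = j") (auto simp: x_def)
    then have "x \<in> alloc"
      using c(1) xi0 by (auto simp: alloc_def x_def)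
    then have "A \<bullet> out x \<le> A \<bullet> L" using A(2) LA by fastforce
    moreover have "A \<bullet> out x = (\<Sum>i\<in>UNIV. a i * mubar i j * c i) + (\<Sum>k\<in>UNIV - {j}. z k)"
      by (subst val, subst sum.remove[of _ j]) (auto simp: x_def z_def intro!: sum.cong)
    moreover have "A \<bullet> L = z j + (\<Sum>k\<in>UNIV - {j}. z k)"
      by (subst sum_z[symmetric], subst sum.remove[of _ j]) auto
    ultimately show ?thesis by simp
  qed
  have z_ge: "a i * mubar i j \<le> z j" for i j
    using column[of "\<lambda>k. if k = i then 1 else 0" j]
    by (simp add: if_distrib cong: if_cong)
  show ?thesis
  proof (intro exI[of _ a] exI[of _ z] conjI allI impI)
    show "\<exists>i. a i \<noteq> 0" using A(1) by (auto simp: a_def vec_eq_iff)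
    show "0 \<le> z j" for j using column[of "\<lambda>_. 0" j] by simp
    show "a i * mubar i j \<le> z j" for i j by (rule z_ge)
    show "a i * mubar i j = z j" if "0 < xi i j" for i j
    proof -
      have "(\<Sum>i\<in>UNIV. xi i j * (z j - a i * mubar i j)) = (\<Sum>i\<in>UNIV. xi i j) * z j - z j"
        unfolding z_def[of j] by (simp add: sum_subtractf sum_distrib_right algebra_simps)
      then have "(\<Sum>i\<in>UNIV. xi i j * (z j - a i * mubar i j)) = 0"
        by (simp add: load1)
      then have "xi i j * (z j - a i * mubar i j) = 0"
        using xi0 z_ge by (subst (asm) sum_nonneg_eq_0_iff) auto
      then show ?thesis using that by simp
    qed
    show "(\<Sum>j\<in>UNIV. z j) = (\<Sum>i\<in>UNIV. a i * lam i)"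
      unfolding sum_z by (simp add: inner_vec_def a_def L_def)
  qed
qed

text \<open>
  Along an edge of the tree the relation \<open>a i * mubar i j = z j\<close> makes the signs of the two end
  points agree, so by connectedness all prices and values have the same sign.  It is not zero,
  as some price is nonzero, and it is not negative, as the values are nonnegative.
\<close>

lemma workload_prices_positive:
  fixes lam :: "'i::finite \<Rightarrow> real" and mubar xi :: "'i \<Rightarrow> 'j::finite \<Rightarrow> real"
  assumes ht: "heavy_traffic lam mubar xi rho"
    and crp: "complete_resource_pooling mubar xi"
  obtains a :: "'i \<Rightarrow> real" and z :: "'j \<Rightarrow> real" where
    "\<And>i. 0 < a i" "\<And>i j. a i * mubar i j \<le> z j"
    "(\<Sum>j\<in>UNIV. z j) = (\<Sum>i\<in>UNIV. a i * lam i)"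
proof -
  obtain a :: "'i \<Rightarrow> real" and z :: "'j \<Rightarrow> real" where a: "\<exists>i. a i \<noteq> 0"
    and z: "\<And>j. 0 \<le> z j" "\<And>i j. a i * mubar i j \<le> z j"
    and tight: "\<And>i j. 0 < xi i j \<Longrightarrow> a i * mubar i j = z j"
    and dual: "(\<Sum>j\<in>UNIV. z j) = (\<Sum>i\<in>UNIV. a i * lam i)"
    using workload_prices[OF ht] by blast
  define w where "w = case_sum a z"
  define R where "R = {(u, v). {u, v} \<in> {{Inl i, Inr j} | i j. 0 < mubar i j \<and> 0 < xi i j}}"
  have conn: "(u, v) \<in> R\<^sup>*" for u v
    using crp by (simp add: complete_resource_pooling_def graph_tree_def graph_connected_def R_def)
  have edge: "sgn (w u) = sgn (w v)" if uv: "(u, v) \<in> R" for u v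
  proof -
    have "sgn (w (Inl i)) = sgn (w (Inr j))" if "0 < mubar i j" "0 < xi i j" for i j
    proof -
      have "sgn (z j) = sgn (a i * mubar i j)" by (simp only: tight[OF that(2)])
      also have "\<dots> = sgn (a i)" using that(1) by (simp add: sgn_mult)
      finally show ?thesis by (simp add: w_def)
    qed
    note Inl_Inr = this
    obtain i j where "{u, v} = {Inl i, Inr j}" and ij: "0 < mubar i j" "0 < xi i j"
      using uv unfolding R_def by blast
    then have "(u = Inl i \<and> v = Inr j) \<or> (u = Inr j \<and> v = Inl i)"
      by (simp only: doubleton_eq_iff)
    then show ?thesis using Inl_Inr[OF ij] by auto
  qed
  have sgn_eq: "sgn (w u) = sgn (w v)" for u v
    using conn[of u v] 
  proof (induction rule: rtrancl_induct)
    case (step u' v')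
    then show ?case using edge[of u' v'] by simp
  qed simp
  obtain i0 where i0: "a i0 \<noteq> 0" using a by blast
  have "0 \<le> sgn (w (Inr undefined))" using z(1) by (simp add: w_def)
  then have "0 < a i0"
    using sgn_eq[of "Inr undefined" "Inl i0"] i0 by (auto simp: w_def sgn_if split: if_splits)
  then have "0 < a i" for i
    using sgn_eq[of "Inl i" "Inl i0"] by (simp add: w_def sgn_1_pos)
  then show ?thesis using z(2) dual by (rule that)
qed

section \<open>Properties holding with high probability\<close>

text \<open>
  Convergence to \<open>1\<close> of the probability that \<open>P n\<close> holds, for properties \<open>P n\<close> that need be
  neither measurable (a statement on all times of an interval, say) nor known for small \<open>n\<close>:
  \<open>P n\<close> is implied, outside a null set and for large \<open>n\<close>, by measurable events of probability
  tending to \<open>1\<close>.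
\<close>

definition whp :: "'w measure \<Rightarrow> (nat \<Rightarrow> 'w \<Rightarrow> bool) \<Rightarrow> bool" where
  "whp M P \<longleftrightarrow> (\<exists>E. (\<forall>n. E n \<in> sets M) \<and> (\<lambda>n. measure M (E n)) \<longlonglongrightarrow> 1 \<and>
     (\<forall>\<^sub>F n in sequentially. AE \<omega> in M. \<omega> \<in> E n \<longrightarrow> P n \<omega>))"

lemma whp_mono:
  assumes "whp M P" "\<forall>\<^sub>F n in sequentially. AE \<omega> in M. P n \<omega> \<longrightarrow> Q n \<omega>"
  shows "whp M Q"
proof -
  obtain E where E: "\<And>n. E n \<in> sets M" "(\<lambda>n. measure M (E n)) \<longlonglongrightarrow> 1"
      "\<forall>\<^sub>F n in sequentially. AE \<omega> in M. \<omega> \<in> E n \<longrightarrow> P n \<omega>"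
    using assms(1) unfolding whp_def by blast
  have "\<forall>\<^sub>F n in sequentially. AE \<omega> in M. \<omega> \<in> E n \<longrightarrow> Q n \<omega>"
    using E(3) assms(2) by eventually_elim (auto elim: eventually_elim2)
  then show ?thesis using E unfolding whp_def by blast
qed

context prob_space
begin

lemma whp_AE:
  assumes "\<forall>\<^sub>F n in sequentially. AE \<omega> in M. P n \<omega>"
  shows "whp M P"
  unfolding whp_def
  by (rule exI[of _ "\<lambda>_. space M"]) (use assms in \<open>auto simp: prob_space\<close>)

lemma whp_conj:
  assumes "whp M P" "whp M Q"
  shows "whp M (\<lambda>n \<omega>. P n \<omega> \<and> Q n \<omega>)"
proof -
  obtain E where E: "\<And>n. E n \<in> sets M" "(\<lambda>n. prob (E n)) \<longlonglongrightarrow> 1"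
      "\<forall>\<^sub>F n in sequentially. AE \<omega> in M. \<omega> \<in> E n \<longrightarrow> P n \<omega>"
    using assms(1) unfolding whp_def by blast
  obtain F where F: "\<And>n. F n \<in> sets M" "(\<lambda>n. prob (F n)) \<longlonglongrightarrow> 1"
      "\<forall>\<^sub>F n in sequentially. AE \<omega> in M. \<omega> \<in> F n \<longrightarrow> Q n \<omega>"
    using assms(2) unfolding whp_def by blast
  have "(\<lambda>n. prob (E n \<inter> F n)) \<longlonglongrightarrow> 1"
  proof (rule tendsto_sandwich[of "\<lambda>n. prob (E n) + prob (F n) - 1" _ _ "\<lambda>_. 1"])
    have "(\<lambda>n. prob (E n) + prob (F n) - 1) \<longlonglongrightarrow> 1 + 1 - 1"
      by (intro tendsto_intros E F)
    then show "(\<lambda>n. prob (E n) + prob (F n) - 1) \<longlonglongrightarrow> 1" by simp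
    have "prob (E n) + prob (F n) - 1 \<le> prob (E n \<inter> F n)" for n
      using measure_Un3[of "E n" M "F n"] prob_le_1[of "E n \<union> F n"] E(1) F(1)
      by (simp add: fmeasurable_eq_sets)
    then show "\<forall>\<^sub>F n in sequentially. prob (E n) + prob (F n) - 1 \<le> prob (E n \<inter> F n)"
      by simp
  qed auto
  moreover have "\<forall>\<^sub>F n in sequentially. AE \<omega> in M. \<omega> \<in> E n \<inter> F n \<longrightarrow> P n \<omega> \<and> Q n \<omega>"
    using E(3) F(3) by eventually_elim (auto elim: eventually_elim2)
  ultimately show ?thesis
    unfolding whp_def using E(1) F(1) by (intro exI[of _ "\<lambda>n. E n \<inter> F n"]) auto
qed

lemma whp_ball_finite:
  assumes "finite I" "\<And>i. i \<in> I \<Longrightarrow> whp M (P i)"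
  shows "whp M (\<lambda>n \<omega>. \<forall>i\<in>I. P i n \<omega>)"
  using assms
proof (induction I rule: finite_induct)
  case empty
  then show ?case by (intro whp_AE) auto
next
  case (insert x I)
  have "whp M (\<lambda>n \<omega>. P x n \<omega> \<and> (\<forall>i\<in>I. P i n \<omega>))"
    using insert by (intro whp_conj) auto
  then show ?case by (rule whp_mono) auto
qed

lemma whp_compl_bound:
  assumes "\<And>n. {\<omega> \<in> space M. \<not> P n \<omega>} \<in> sets M"
    and "\<forall>\<^sub>F n in sequentially. prob {\<omega> \<in> space M. \<not> P n \<omega>} \<le> f n"
    and "f \<longlonglongrightarrow> 0"
  shows "whp M P"
proof -
  define B where "B n = {\<omega> \<in> space M. \<not> P n \<omega>}" for n
  have B: "B n \<in> sets M" for n using assms(1) by (simp add: B_def)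
  have "(\<lambda>n. prob (B n)) \<longlonglongrightarrow> 0"
    by (rule tendsto_sandwich[of "\<lambda>_. 0" _ _ f]) (use assms(2,3) in \<open>auto simp: B_def\<close>)
  then have "(\<lambda>n. 1 - prob (B n)) \<longlonglongrightarrow> 1 - 0" by (intro tendsto_intros)
  then have "(\<lambda>n. prob (space M - B n)) \<longlonglongrightarrow> 1" using B by (simp add: prob_compl)
  then show ?thesis
    unfolding whp_def using B
    by (intro exI[of _ "\<lambda>n. space M - B n"]) (auto simp: B_def)
qed

lemma whp_prob_tendsto_1:
  assumes "whp M P" "\<forall>\<^sub>F n in sequentially. {\<omega> \<in> space M. P n \<omega>} \<in> sets M"
  shows "(\<lambda>n. prob {\<omega> \<in> space M. P n \<omega>}) \<longlonglongrightarrow> 1"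
proof -
  obtain E where E: "\<And>n. E n \<in> sets M" "(\<lambda>n. prob (E n)) \<longlonglongrightarrow> 1"
      "\<forall>\<^sub>F n in sequentially. AE \<omega> in M. \<omega> \<in> E n \<longrightarrow> P n \<omega>"
    using assms(1) unfolding whp_def by blast
  show ?thesis
  proof (rule tendsto_sandwich[OF _ _ E(2) tendsto_const])
    show "\<forall>\<^sub>F n in sequentially. prob (E n) \<le> prob {\<omega> \<in> space M. P n \<omega>}"
      using E(3) assms(2)
      by eventually_elim (auto intro!: finite_measure_mono_AE elim!: eventually_mono
             dest: sets.sets_into_space[OF E(1), THEN subsetD])
  qed auto
qed

end

section \<open>Upper bounds for Poisson processes\<close>

text \<open>
  Chernoff's bound: Markov's inequality for \<open>c ^ k\<close>, whose mean is \<open>exp (r * (c - 1))\<close>.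
\<close>

lemma poisson_pmf_upper_tail:
  assumes r: "0 < r" and c: "1 < c"
  shows "measure_pmf.prob (poisson_pmf r) {k. x \<le> real k} \<le> exp (r * (c - 1) - x * ln c)"
proof -
  have sums: "(\<lambda>k. (c * r) ^ k / fact k * exp (- r)) sums (exp (c * r) * exp (- r))"
    using exp_converges[of "c * r"] by (intro sums_mult2) (simp add: field_simps)
  have gen: "(\<integral>\<^sup>+k. ennreal (c ^ k) \<partial>measure_pmf (poisson_pmf r)) = ennreal (exp (r * (c - 1)))"
  proof -
    have "(\<integral>\<^sup>+k. ennreal (c ^ k) \<partial>measure_pmf (poisson_pmf r)) =
        (\<Sum>k. ennreal (pmf (poisson_pmf r) k) * ennreal (c ^ k))"
      by (simp add: nn_integral_measure_pmf nn_integral_count_space_nat)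
    also have "\<dots> = (\<Sum>k. ennreal ((c * r) ^ k / fact k * exp (- r)))"
      using r c by (simp add: ennreal_mult[symmetric] power_mult_distrib mult_ac)
    also have "\<dots> = ennreal (exp (c * r) * exp (- r))"
      using sums r c by (intro suminf_ennreal_eq) auto
    finally show ?thesis by (simp add: algebra_simps flip: exp_add)
  qed
  have "emeasure (measure_pmf (poisson_pmf r)) {k. x \<le> real k}
      \<le> ennreal (exp (- x * ln c)) * (\<integral>\<^sup>+k. ennreal (c ^ k) \<partial>measure_pmf (poisson_pmf r))"
  proof -
    have "emeasure (measure_pmf (poisson_pmf r)) {k. x \<le> real k} =
        (\<integral>\<^sup>+k. indicator {k. x \<le> real k} k \<partial>measure_pmf (poisson_pmf r))"
      by simp
    also have "\<dots> \<le> (\<integral>\<^sup>+k. ennreal (exp (- x * ln c)) * ennreal (c ^ k) \<partial>measure_pmf (poisson_pmf r))"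
    proof (intro nn_integral_mono)
      fix k :: nat
      have "1 \<le> exp (- x * ln c) * c ^ k" if "x \<le> real k"
      proof -
        have "1 \<le> exp ((real k - x) * ln c)" using that c by simp
        also have "\<dots> = exp (- x * ln c) * exp (real k * ln c)"
          by (simp add: algebra_simps flip: exp_add)
        also have "exp (real k * ln c) = c ^ k"
          using c by (simp add: exp_of_nat_mult)
        finally show ?thesis .
      qed
      then show "indicator {k. x \<le> real k} k \<le> ennreal (exp (- x * ln c)) * ennreal (c ^ k)"
        using c by (auto simp: indicator_def ennreal_mult[symmetric] simp flip: ennreal_1)
    qed
    also have "\<dots> = ennreal (exp (- x * ln c)) * (\<integral>\<^sup>+k. ennreal (c ^ k) \<partial>measure_pmf (poisson_pmf r))"
      by (rule nn_integral_cmult) simp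
    finally show ?thesis .
  qed
  also have "\<dots> = ennreal (exp (r * (c - 1) - x * ln c))"
    unfolding gen by (simp add: ennreal_mult[symmetric] flip: exp_add)
  finally show ?thesis
    by (simp add: measure_pmf.emeasure_eq_measure)
qed

context prob_space
begin

text \<open>
  The Poisson tail bound decays exponentially in \<open>n\<close> once its parameter \<open>c = 1 + h\<close> is close
  enough to \<open>1\<close>: the exponent per unit of \<open>n\<close> is \<open>q * h - (q + e / 2) * ln (1 + h)\<close>, with
  derivative \<open>- e / 2\<close> at \<open>h = 0\<close>.  Half of \<open>e\<close> pays for the convergence of the rates, which
  brings the means below \<open>q * n\<close>, the other half for the fluctuations.
\<close>

lemma poisson_process_bound_at:
  assumes S: "\<And>n. 0 < n \<Longrightarrow> poisson_process M (r n) (S n)"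
    and r: "r \<longlonglongrightarrow> rho" and rho: "0 \<le> rho" and s: "0 < s" and e: "0 < e"
  shows "whp M (\<lambda>n \<omega>. real (S n (s * real n) \<omega>) \<le> (rho * s + e) * real n)"
proof -
  define q where "q = rho * s + e / 2"
  define V where "V n \<omega> = S n (s * real n) \<omega> - S n 0 \<omega>" for n \<omega>
  have q: "0 < q" using rho s e by (simp add: q_def add_nonneg_pos)
  \<comment> \<open>Small enough for the quadratic error in \<open>h - h\<^sup>2 \<le> ln (1 + h)\<close> to take at most half of the gain.\<close>
  define h where "h = e / (4 * (q + e))"
  have h: "0 < h" "h \<le> 1" using q e by (auto simp: h_def field_simps)
  define d where "d = (q + e / 2) * ln (1 + h) - q * h"
  have "0 < h * (e / 4)" using h e by simp
  also have "\<dots> \<le> h * (e / 2 - (q + e / 2) * h)"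
  proof (intro mult_left_mono)
    have "(q + e / 2) * h \<le> (q + e) * h" using h e by (intro mult_right_mono) auto
    also have "\<dots> = e / 4" using q e by (simp add: h_def field_simps)
    finally show "e / 4 \<le> e / 2 - (q + e / 2) * h" by simp
  qed (use h in simp)
  also have "\<dots> = (q + e / 2) * (h - h\<^sup>2) - q * h"
    by (simp add: algebra_simps power2_eq_square)
  also have "\<dots> \<le> d"
    unfolding d_def using ln_one_plus_pos_lower_bound[of h] h q e
    by (intro diff_mono mult_left_mono) auto
  finally have d: "0 < d" .
  have V_meas: "V n \<in> M \<rightarrow>\<^sub>M count_space UNIV" if "0 < n" for n
  proof -
    have [measurable]: "S n t \<in> M \<rightarrow>\<^sub>M count_space UNIV" if "0 \<le> t" for t
      using S[OF \<open>0 < n\<close>] that by (simp add: poisson_process_def)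
    have [measurable]: "S n (s * real n) \<in> M \<rightarrow>\<^sub>M count_space UNIV" "S n 0 \<in> M \<rightarrow>\<^sub>M count_space UNIV"
      using s by auto
    show ?thesis unfolding V_def by measurable
  qed
  \<comment> \<open>The index \<open>0\<close> is excluded because \<open>S 0\<close> is an arbitrary function, so that its event need not be measurable.\<close>
  have "whp M (\<lambda>n \<omega>. n = 0 \<or> real (V n \<omega>) < (q + e / 2) * real n)"
  proof (rule whp_compl_bound)
    fix n
    show "{\<omega> \<in> space M. \<not> (n = 0 \<or> real (V n \<omega>) < (q + e / 2) * real n)} \<in> sets M"
    proof (cases "n = 0")
      case False
      then have [measurable]: "V n \<in> M \<rightarrow>\<^sub>M count_space UNIV" using V_meas by simp
      show ?thesis by measurable
    qed simp
  next
    have "(\<lambda>n. r n * s) \<longlonglongrightarrow> rho * s" by (intro tendsto_intros r)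
    then have "\<forall>\<^sub>F n in sequentially. r n * s < q"
      by (rule order_tendstoD) (use e in \<open>simp add: q_def\<close>)
    then show "\<forall>\<^sub>F n in sequentially.
        prob {\<omega> \<in> space M. \<not> (n = 0 \<or> real (V n \<omega>) < (q + e / 2) * real n)} \<le> exp (- d * real n)"
      using eventually_gt_at_top[of 0]
    proof eventually_elim
      case (elim n)
      let ?x = "(q + e / 2) * real n"
      have rn: "0 < r n" using S[OF elim(2)] by (simp add: poisson_process_def)
      have dist: "distr M (count_space UNIV) (V n) = measure_pmf (poisson_pmf (r n * (s * real n)))"
        using S[OF elim(2)] s elim unfolding poisson_process_def V_def by simp
      have "prob {\<omega> \<in> space M. \<not> (n = 0 \<or> real (V n \<omega>) < ?x)} = prob (V n -` {k. ?x \<le> real k} \<inter> space M)"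
        using elim by (intro arg_cong[where f = prob]) auto
      also have "\<dots> = measure_pmf.prob (poisson_pmf (r n * (s * real n))) {k. ?x \<le> real k}"
        unfolding dist[symmetric] using V_meas[OF elim(2)] by (simp add: measure_distr)
      also have "\<dots> \<le> exp (r n * (s * real n) * ((1 + h) - 1) - ?x * ln (1 + h))"
        using rn s elim h by (intro poisson_pmf_upper_tail) auto
      also have "\<dots> \<le> exp (- d * real n)"
      proof -
        have "(r n * s) * (h * real n) \<le> q * (h * real n)"
          using elim h by (intro mult_right_mono) auto
        then show ?thesis by (simp add: d_def algebra_simps)
      qed
      finally show ?case .
    qed
    show "(\<lambda>n. exp (- d * real n)) \<longlonglongrightarrow> 0"
      using d by real_asymp
  qed
  then show ?thesis
  proof (rule whp_mono)
    show "\<forall>\<^sub>F n in sequentially. AE \<omega> in M. (n = 0 \<or> real (V n \<omega>) < (q + e / 2) * real n) \<longrightarrow>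
        real (S n (s * real n) \<omega>) \<le> (rho * s + e) * real n"
      using eventually_gt_at_top[of 0]
    proof eventually_elim
      case (elim n)
      have "AE \<omega> in M. S n 0 \<omega> = 0"
        using S[OF elim] by (auto simp: poisson_process_def elim: eventually_mono)
      then show ?case
      proof eventually_elim
        case (elim \<omega>)
        then show ?case using \<open>0 < n\<close> by (auto simp: V_def q_def add.commute)
      qed
    qed
  qed
qed

text \<open>
  Paths are nondecreasing, so a bound at the points of a grid of mesh \<open>d * n\<close> extends to the
  whole interval at the price of the mean growth \<open>rho * d * n\<close> over one cell.  The number of grid
  points does not depend on \<open>n\<close>.
\<close>

lemma poisson_process_bound_uniform:
  assumes S: "\<And>n. 0 < n \<Longrightarrow> poisson_process M (r n) (S n)"
    and r: "r \<longlonglongrightarrow> rho" and rho: "0 \<le> rho" and e: "0 < e"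
  shows "whp M (\<lambda>n \<omega>. \<forall>s\<in>{0..K * real n}. real (S n s \<omega>) \<le> rho * s + e * real n)"
proof -
  define d where "d = e / (2 * (rho + 1))"
  have d: "0 < d" using rho e by (simp add: d_def)
  have rho_d: "rho * d \<le> e / 2" using rho e by (simp add: d_def field_simps)
  define m where "m = Suc (nat \<lfloor>K / d\<rfloor>)"
  have "whp M (\<lambda>n \<omega>. \<forall>k\<in>{1..m}. real (S n (real k * d * real n) \<omega>) \<le> (rho * (real k * d) + e / 2) * real n)"
    using d e by (intro whp_ball_finite poisson_process_bound_at[OF S r rho]) auto
  then show ?thesis
  proof (rule whp_mono)
    show "\<forall>\<^sub>F n in sequentially. AE \<omega> in M.
        (\<forall>k\<in>{1..m}. real (S n (real k * d * real n) \<omega>) \<le> (rho * (real k * d) + e / 2) * real n) \<longrightarrow>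
        (\<forall>s\<in>{0..K * real n}. real (S n s \<omega>) \<le> rho * s + e * real n)"
      using eventually_gt_at_top[of 0]
    proof eventually_elim
      case (elim n)
      have "AE \<omega> in M. mono_on {0..} (\<lambda>t. S n t \<omega>)"
        using S[OF elim] by (auto simp: poisson_process_def elim: eventually_mono)
      then show ?case
      proof (eventually_elim, intro impI ballI)
        fix \<omega> s
        assume mono: "mono_on {0..} (\<lambda>t. S n t \<omega>)"
          and grid: "\<forall>k\<in>{1..m}. real (S n (real k * d * real n) \<omega>) \<le> (rho * (real k * d) + e / 2) * real n"
          and s: "s \<in> {0..K * real n}"
        \<comment> \<open>The argument \<open>s\<close> lies in the cell that ends at grid point \<open>k\<close>.\<close>
        define y where "y = s / (d * real n)"
        define k where "k = Suc (nat \<lfloor>y\<rfloor>)"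
        have dn: "0 < d * real n" using d elim by simp
        have y0: "0 \<le> y" using s dn by (simp add: y_def)
        have "y \<le> K / d" using s d elim by (auto simp: y_def field_simps)
        then have "k \<in> {1..m}"
          by (auto simp: k_def m_def intro!: nat_mono floor_mono)
        have ky: "y \<le> real k" "real k \<le> y + 1"
          using y0 by (auto simp: k_def) linarith+
        have s_y: "s = y * (d * real n)" using d elim by (simp add: y_def)
        have "s \<le> real k * d * real n"
          using ky(1) dn mult_right_mono[of y "real k" "d * real n"] by (simp add: s_y mult_ac)
        then have "S n s \<omega> \<le> S n (real k * d * real n) \<omega>"
          using s by (intro mono_onD[OF mono]) auto
        then have "real (S n s \<omega>) \<le> (rho * (real k * d) + e / 2) * real n"
          using grid \<open>k \<in> {1..m}\<close> by force
        also have "\<dots> = rho * (real k * (d * real n)) + e / 2 * real n"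
          by (simp add: algebra_simps)
        also have "\<dots> \<le> rho * ((y + 1) * (d * real n)) + e / 2 * real n"
          using ky rho dn by (intro add_mono mult_left_mono mult_right_mono) auto
        also have "\<dots> = rho * s + (rho * d) * real n + e / 2 * real n"
          by (simp add: s_y algebra_simps)
        also have "(rho * d) * real n \<le> e / 2 * real n"
          using rho_d by (intro mult_right_mono) auto
        finally show "real (S n s \<omega>) \<le> rho * s + e * real n" by simp
      qed
    qed
  qed
qed

end

text \<open>
  The sign condition says that a rate vanishes exactly when its limit does, so the sequence
  consists of Poisson processes only or of zero processes only.
\<close>

lemma (in prob_space) service_process_bound_uniform:
  assumes S: "\<And>n. 0 < n \<Longrightarrow> service_process M (r n) (S n)"
    and sgn: "\<And>n. 0 < n \<Longrightarrow> 0 \<le> r n \<and> (0 < r n \<longleftrightarrow> 0 < rho)"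
    and r: "r \<longlonglongrightarrow> rho" and e: "0 < e"
  shows "whp M (\<lambda>n \<omega>. \<forall>s\<in>{0..K * real n}. real (S n s \<omega>) \<le> rho * s + e * real n)"
proof (cases "0 < rho")
  case True
  have "poisson_process M (r n) (S n)" if "0 < n" for n
    using S[OF that] sgn[OF that] True by (auto simp: service_process_def)
  then show ?thesis
    using r True e by (intro poisson_process_bound_uniform[where r = r]) auto
next
  case False
  have "0 \<le> rho"
    using r by (rule LIMSEQ_le_const) (use sgn in \<open>auto intro!: exI[of _ 1]\<close>)
  with False have rho: "rho = 0" by simp
  show ?thesis
  proof (rule whp_AE)
    show "\<forall>\<^sub>F n in sequentially. AE \<omega> in M.
        \<forall>s\<in>{0..K * real n}. real (S n s \<omega>) \<le> rho * s + e * real n"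
      using eventually_gt_at_top[of 0]
    proof eventually_elim
      case (elim n)
      have "r n = 0" using sgn[OF elim] False by simp
      then have "AE \<omega> in M. \<forall>t\<ge>0. S n t \<omega> = 0"
        using S[OF elim] by (simp add: service_process_def)
      then show ?case by eventually_elim (use e rho in auto)
    qed
  qed
qed

section \<open>Lower bounds for renewal processes\<close>

context prob_space
begin

text \<open>
  Independent centred variables are orthogonal in \<open>L\<^sup>2\<close>.
\<close>

lemma second_moment_sum_indep:
  fixes W :: "'k \<Rightarrow> 'a \<Rightarrow> real"
  assumes I: "finite I" and indep: "indep_vars (\<lambda>_. borel) W I"
    and sq: "\<And>k. k \<in> I \<Longrightarrow> integrable M (\<lambda>\<omega>. (W k \<omega>)\<^sup>2)"
    and mean: "\<And>k. k \<in> I \<Longrightarrow> expectation (W k) = 0"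
  shows "integrable M (\<lambda>\<omega>. (\<Sum>k\<in>I. W k \<omega>)\<^sup>2)"
    and "expectation (\<lambda>\<omega>. (\<Sum>k\<in>I. W k \<omega>)\<^sup>2) = (\<Sum>k\<in>I. expectation (\<lambda>\<omega>. (W k \<omega>)\<^sup>2))"
proof -
  have rv: "W k \<in> borel_measurable M" if "k \<in> I" for k
    using indep that by (auto simp: indep_vars_def)
  have int: "integrable M (W k)" if "k \<in> I" for k
    using rv sq that by (blast intro: square_integrable_imp_integrable)
  have expand: "(\<Sum>k\<in>I. W k \<omega>)\<^sup>2 = (\<Sum>k\<in>I. \<Sum>l\<in>I. W k \<omega> * W l \<omega>)" for \<omega>
    by (simp add: power2_eq_square sum_product)
  have pair: "integrable M (\<lambda>\<omega>. W k \<omega> * W l \<omega>) \<and>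
      expectation (\<lambda>\<omega>. W k \<omega> * W l \<omega>) = (if k = l then expectation (\<lambda>\<omega>. (W k \<omega>)\<^sup>2) else 0)"
    if "k \<in> I" "l \<in> I" for k l
  proof (cases "k = l")
    case True
    then show ?thesis using sq[OF that(1)] by (simp add: power2_eq_square)
  next
    case False
    have kl: "indep_vars (\<lambda>_. borel) W {k, l}"
      using indep that by (intro indep_vars_subset[OF indep]) auto
    have "integrable M (\<lambda>\<omega>. \<Prod>i\<in>{k, l}. W i \<omega>)"
      by (rule indep_vars_integrable[OF _ kl]) (use int that in auto)
    moreover have "expectation (\<lambda>\<omega>. \<Prod>i\<in>{k, l}. W i \<omega>) = (\<Prod>i\<in>{k, l}. expectation (W i))"
      by (rule indep_vars_lebesgue_integral[OF _ kl]) (use int that in auto)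
    ultimately show ?thesis using False mean that by simp
  qed
  show "integrable M (\<lambda>\<omega>. (\<Sum>k\<in>I. W k \<omega>)\<^sup>2)"
    unfolding expand using pair by (intro Bochner_Integration.integrable_sum) auto
  show "expectation (\<lambda>\<omega>. (\<Sum>k\<in>I. W k \<omega>)\<^sup>2) = (\<Sum>k\<in>I. expectation (\<lambda>\<omega>. (W k \<omega>)\<^sup>2))"
    unfolding expand using pair I
    by (simp add: Bochner_Integration.integral_sum Bochner_Integration.integrable_sum)
qed

text \<open>
  Chebyshev's inequality.  The sum is taken over the index set \<open>{i} \<times> {1..l}\<close>, for which the
  independence of the doubly indexed family is available directly.
\<close>

lemma interarrival_sum_deviation:
  assumes U: "interarrival_sequences M U" and x: "0 < x"
  shows "prob {\<omega> \<in> space M. x \<le> \<bar>(\<Sum>k=1..l. U i k \<omega>) - real l\<bar>}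
    \<le> real l * expectation (\<lambda>\<omega>. (U i 1 \<omega> - 1)\<^sup>2) / x\<^sup>2"
proof -
  define W where "W p \<omega> = (case p of (i, k) \<Rightarrow> U i k) \<omega> - 1" for p \<omega>
  define I where "I = {i} \<times> {1..l}"
  have I: "finite I" by (simp add: I_def)
  have sum_I: "(\<Sum>p\<in>I. W p \<omega>) = (\<Sum>k=1..l. U i k \<omega>) - real l" for \<omega>
  proof -
    have "(\<Sum>p\<in>I. W p \<omega>) = (\<Sum>k=1..l. W (i, k) \<omega>)"
      unfolding I_def by (simp add: sum.cartesian_product')
    then show ?thesis by (simp add: W_def sum_subtractf)
  qed
  have int: "integrable M (U i k)" "integrable M (\<lambda>\<omega>. (U i k \<omega>)\<^sup>2)" "expectation (U i k) = 1"
    and dist: "distr M borel (U i k) = distr M borel (U i 1)" if "1 \<le> k" for k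
    using U that unfolding interarrival_sequences_def by blast+
  have "indep_vars (\<lambda>_. borel) (\<lambda>(i, k). U i k) I"
    using U unfolding interarrival_sequences_def I_def by (auto intro: indep_vars_subset)
  then have indep: "indep_vars (\<lambda>_. borel) W I"
    unfolding W_def by (rule indep_vars_compose2[where Y = "\<lambda>_ u. u - 1"]) simp
  have sq: "integrable M (\<lambda>\<omega>. (W p \<omega>)\<^sup>2)" if "p \<in> I" for p
    using that int by (auto simp: W_def I_def power2_diff)
  have mean: "expectation (W p) = 0" if "p \<in> I" for p
    using that int by (auto simp: W_def[abs_def] I_def prob_space)
  have var: "expectation (\<lambda>\<omega>. (W p \<omega>)\<^sup>2) = expectation (\<lambda>\<omega>. (U i 1 \<omega> - 1)\<^sup>2)" if p: "p \<in> I" for p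
  proof -
    obtain k where k: "p = (i, k)" "1 \<le> k" using p by (auto simp: I_def)
    have [measurable]: "U i k \<in> borel_measurable M" "U i 1 \<in> borel_measurable M"
      using int(1)[of k] int(1)[of 1] k by (auto intro: borel_measurable_integrable)
    have "(\<integral>u. (u - 1)\<^sup>2 \<partial>distr M borel (U i k)) = (\<integral>u. (u - 1)\<^sup>2 \<partial>distr M borel (U i 1))"
      by (simp only: dist[OF k(2)])
    then show ?thesis by (simp add: integral_distr W_def k del: One_nat_def)
  qed
  note mom = second_moment_sum_indep[OF I indep sq mean]
  have "(\<lambda>\<omega>. \<Sum>p\<in>I. W p \<omega>) \<in> borel_measurable M"
    using indep by (intro borel_measurable_sum) (simp add: indep_vars_def)
  then have "prob {\<omega> \<in> space M. x \<le> \<bar>\<Sum>p\<in>I. W p \<omega>\<bar>} \<le> expectation (\<lambda>\<omega>. (\<Sum>p\<in>I. W p \<omega>)\<^sup>2) / x\<^sup>2"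
    using x mom(1) by (intro second_moment_method)
  also have "\<dots> = real l * expectation (\<lambda>\<omega>. (U i 1 \<omega> - 1)\<^sup>2) / x\<^sup>2"
    by (subst mom(2)) (simp_all add: var, simp add: I_def)
  finally show ?thesis by (simp add: sum_I)
qed

text \<open>
  This makes the set in the definition of \<open>arrivals\<close> finite, so that its supremum is a genuine
  one.  By Chebyshev's inequality the \<open>l\<close>-th partial sum stays below a fixed \<open>c\<close> with
  probability of order \<open>1 / l\<close>.  Hence almost surely some partial sum exceeds \<open>c\<close>, and by
  positivity of the summands so do all later ones.
\<close>

lemma interarrival_sums_unbounded:
  assumes U: "interarrival_sequences M U"
  shows "AE \<omega> in M. \<forall>c. finite {l. (\<Sum>k=1..l. U i k \<omega>) \<le> c}"
proof -
  define v where "v = expectation (\<lambda>\<omega>. (U i 1 \<omega> - 1)\<^sup>2)"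
  have [measurable]: "U i k \<in> borel_measurable M" if "k \<in> {1..l}" for k l
    using U that unfolding interarrival_sequences_def
    by (auto intro: borel_measurable_integrable)
  have "AE \<omega> in M. \<exists>l. real c < (\<Sum>k=1..l. U i k \<omega>)" for c :: nat
  proof -
    define B where "B = {\<omega> \<in> space M. \<forall>l. (\<Sum>k=1..l. U i k \<omega>) \<le> real c}"
    have B: "B \<in> sets M" unfolding B_def by measurable
    have "prob B \<le> real l * v / (real l - real c)\<^sup>2" if "c < l" for l
    proof -
      have "prob B \<le> prob {\<omega> \<in> space M. real l - real c \<le> \<bar>(\<Sum>k=1..l. U i k \<omega>) - real l\<bar>}"
      proof (rule finite_measure_mono)
        show "B \<subseteq> {\<omega> \<in> space M. real l - real c \<le> \<bar>(\<Sum>k=1..l. U i k \<omega>) - real l\<bar>}"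
        proof
          fix \<omega> assume "\<omega> \<in> B"
          then have "\<omega> \<in> space M" "(\<Sum>k=1..l. U i k \<omega>) \<le> real c" by (auto simp: B_def)
          then show "\<omega> \<in> {\<omega> \<in> space M. real l - real c \<le> \<bar>(\<Sum>k=1..l. U i k \<omega>) - real l\<bar>}"
            by auto
        qed
        show "{\<omega> \<in> space M. real l - real c \<le> \<bar>(\<Sum>k=1..l. U i k \<omega>) - real l\<bar>} \<in> sets M"
          by measurable
      qed
      also have "\<dots> \<le> real l * v / (real l - real c)\<^sup>2"
        unfolding v_def using that by (intro interarrival_sum_deviation[OF U]) simp
      finally show ?thesis .
    qed
    then have "\<forall>\<^sub>F l in sequentially. prob B \<le> real l * v / (real l - real c)\<^sup>2"
      by (rule eventually_mono[OF eventually_gt_at_top[of c]])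
    moreover have "(\<lambda>l. real l * v / (real l - real c)\<^sup>2) \<longlonglongrightarrow> 0" by real_asymp
    ultimately have "prob B \<le> 0"
      by (intro tendsto_lowerbound[of _ 0 sequentially]) auto
    then have "B \<in> null_sets M"
      using B by (auto intro!: null_setsI simp: emeasure_eq_measure ennreal_eq_0_iff)
    then have "AE \<omega> in M. \<omega> \<notin> B" by (rule AE_not_in)
    with AE_space show ?thesis
      by eventually_elim (auto simp: B_def not_le)
  qed
  then have "AE \<omega> in M. \<forall>c :: nat. \<exists>l. real c < (\<Sum>k=1..l. U i k \<omega>)"
    by (simp add: AE_all_countable)
  moreover have "AE \<omega> in M. \<forall>k\<in>{1..}. 0 < U i k \<omega>"
    using U by (subst AE_ball_countable) (auto simp: interarrival_sequences_def)
  ultimately show ?thesis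
  proof (eventually_elim, intro allI)
    fix \<omega> and c :: real
    assume unb: "\<forall>c :: nat. \<exists>l. real c < (\<Sum>k=1..l. U i k \<omega>)"
      and pos: "\<forall>k\<in>{1..}. 0 < U i k \<omega>"
    obtain l where l: "real (nat \<lceil>c\<rceil>) < (\<Sum>k=1..l. U i k \<omega>)" using unb by blast
    have "l' \<le> l" if "(\<Sum>k=1..l'. U i k \<omega>) \<le> c" for l'
    proof (rule ccontr)
      assume "\<not> l' \<le> l"
      then have "(\<Sum>k=1..l. U i k \<omega>) \<le> (\<Sum>k=1..l'. U i k \<omega>)"
        using pos by (intro sum_mono2) (auto intro: less_imp_le)
      with that l show False by linarith
    qed
    then have "{l. (\<Sum>k=1..l. U i k \<omega>) \<le> c} \<subseteq> {..l}" by auto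
    then show "finite {l. (\<Sum>k=1..l. U i k \<omega>) \<le> c}" by (rule finite_subset) simp
  qed
qed

text \<open>
  There are at least \<open>L\<close> arrivals up to time \<open>t\<close> as soon as the first \<open>L\<close> interarrival times,
  which are about \<open>L / rate\<close> in total, add up to at most \<open>t\<close>.  For \<open>L\<close> close to
  \<open>(l * t - e) * n\<close> the margin is of order \<open>n\<close>, while the standard deviation is of order \<open>sqrt n\<close>.
\<close>

lemma arrivals_lower_bound:
  assumes U: "interarrival_sequences M U"
    and pos: "\<And>n. 0 < n \<Longrightarrow> 0 < rate n i"
    and lim: "(\<lambda>n. rate n i / real n) \<longlonglongrightarrow> l" and e: "0 < e"
  shows "whp M (\<lambda>n \<omega>. (l * t - e) * real n \<le> real (arrivals U (rate n) i t \<omega>))"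
proof (cases "l * t - e \<le> 0")
  case True
  then have "(l * t - e) * real n \<le> real (arrivals U (rate n) i t \<omega>)" for n \<omega>
    by (meson mult_nonpos_nonneg of_nat_0_le_iff order_trans)
  then show ?thesis by (intro whp_AE) auto
next
  case False
  define a where "a = l * t - e"
  have a: "0 < a" using False by (simp add: a_def)
  define L where "L n = nat \<lceil>a * real n\<rceil>" for n
  have L: "a * real n \<le> real (L n)" "real (L n) \<le> a * real n + 1" for n
  proof -
    have "0 \<le> a * real n" using a by simp
    then show "a * real n \<le> real (L n)" "real (L n) \<le> a * real n + 1"
      unfolding L_def by linarith+
  qed
  define v where "v = expectation (\<lambda>\<omega>. (U i 1 \<omega> - 1)\<^sup>2)"
  have v: "0 \<le> v" by (simp add: v_def)
  have [measurable]: "U i k \<in> borel_measurable M" if "k \<in> {1..l}" for k l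
    using U that unfolding interarrival_sequences_def
    by (auto intro: borel_measurable_integrable)
  have "whp M (\<lambda>n \<omega>. \<bar>(\<Sum>k=1..L n. U i k \<omega>) - real (L n)\<bar> < e / 2 * real n)"
  proof (rule whp_compl_bound)
    show "{\<omega> \<in> space M. \<not> \<bar>(\<Sum>k=1..L n. U i k \<omega>) - real (L n)\<bar> < e / 2 * real n} \<in> sets M" for n
      by measurable
    show "\<forall>\<^sub>F n in sequentially.
        prob {\<omega> \<in> space M. \<not> \<bar>(\<Sum>k=1..L n. U i k \<omega>) - real (L n)\<bar> < e / 2 * real n}
        \<le> (a * real n + 1) * v / (e / 2 * real n)\<^sup>2"
      using eventually_gt_at_top[of 0]
    proof eventually_elim
      case (elim n)
      have "prob {\<omega> \<in> space M. \<not> \<bar>(\<Sum>k=1..L n. U i k \<omega>) - real (L n)\<bar> < e / 2 * real n}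
          \<le> real (L n) * v / (e / 2 * real n)\<^sup>2"
        unfolding v_def not_less using e elim by (intro interarrival_sum_deviation[OF U]) simp
      also have "\<dots> \<le> (a * real n + 1) * v / (e / 2 * real n)\<^sup>2"
        using L v by (intro divide_right_mono mult_right_mono) auto
      finally show ?case .
    qed
    show "(\<lambda>n. (a * real n + 1) * v / (e / 2 * real n)\<^sup>2) \<longlonglongrightarrow> 0"
      using e by real_asymp
  qed
  then show ?thesis
  proof (rule whp_mono)
    have "(\<lambda>n. t * (rate n i / real n) - (a + e / 2 + 1 / real n)) \<longlonglongrightarrow> t * l - (a + e / 2 + 0)"
      by (intro tendsto_intros lim lim_1_over_n)
    then have "\<forall>\<^sub>F n in sequentially. 0 < t * (rate n i / real n) - (a + e / 2 + 1 / real n)"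
      by (rule order_tendstoD) (use e in \<open>simp add: a_def algebra_simps\<close>)
    then show "\<forall>\<^sub>F n in sequentially. AE \<omega> in M.
        \<bar>(\<Sum>k=1..L n. U i k \<omega>) - real (L n)\<bar> < e / 2 * real n \<longrightarrow>
        (l * t - e) * real n \<le> real (arrivals U (rate n) i t \<omega>)"
      using eventually_gt_at_top[of 0]
    proof eventually_elim
      case (elim n)
      have room: "a * real n + 1 + e / 2 * real n \<le> t * rate n i"
        using elim by (simp add: field_simps)
      show ?case
        using interarrival_sums_unbounded[OF U, of i]
      proof (eventually_elim, intro impI)
        fix \<omega>
        assume fin: "\<forall>c. finite {l. (\<Sum>k=1..l. U i k \<omega>) \<le> c}"
          and dev: "\<bar>(\<Sum>k=1..L n. U i k \<omega>) - real (L n)\<bar> < e / 2 * real n"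
        let ?A = "{l. (\<Sum>k=1..l. U i k \<omega> / rate n i) \<le> t}"
        have A_eq: "?A = {l. (\<Sum>k=1..l. U i k \<omega>) \<le> t * rate n i}"
          using pos[OF elim(2)] by (simp add: sum_divide_distrib[symmetric] pos_divide_le_eq)
        have "(\<Sum>k=1..L n. U i k \<omega>) \<le> t * rate n i"
          using dev L(2)[of n] room by linarith
        then have "L n \<in> ?A" by (simp only: A_eq mem_Collect_eq)
        moreover have "finite ?A" unfolding A_eq using fin by blast
        ultimately have "L n \<le> arrivals U (rate n) i t \<omega>"
          unfolding arrivals_def by (intro cSup_upper bdd_above_finite)
        then show "(l * t - e) * real n \<le> real (arrivals U (rate n) i t \<omega>)"
          using L(1)[of n] by (simp add: a_def[symmetric])
      qed
    qed
  qed
qed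

end

section \<open>Growth of the workload\<close>

text \<open>
  An integral that does not exist has the value \<open>0\<close>, and dropping the corresponding nonnegative
  terms only decreases the sum of the integrands.  For busy times
  this is the fact that a station with \<open>c\<close> servers works at most \<open>c * t\<close> server hours up to time \<open>t\<close>.
\<close>

lemma sum_integral_le:
  fixes f :: "'i \<Rightarrow> real \<Rightarrow> real"
  assumes "finite I" "0 \<le> t"
    and nonneg: "\<And>i s. i \<in> I \<Longrightarrow> s \<in> {0..t} \<Longrightarrow> 0 \<le> f i s"
    and bound: "\<And>s. s \<in> {0..t} \<Longrightarrow> (\<Sum>i\<in>I. f i s) \<le> c"
  shows "(\<Sum>i\<in>I. integral {0..t} (f i)) \<le> c * t"
proof -
  define J where "J = {i \<in> I. f i integrable_on {0..t}}"
  have J: "finite J" "J \<subseteq> I" using assms(1) by (auto simp: J_def)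
  have "(\<Sum>i\<in>I. integral {0..t} (f i)) = (\<Sum>i\<in>J. integral {0..t} (f i))"
    using assms(1) by (intro sum.mono_neutral_right) (auto simp: J_def not_integrable_integral)
  also have "\<dots> = integral {0..t} (\<lambda>s. \<Sum>i\<in>J. f i s)"
    using J by (intro integral_sum[symmetric]) (auto simp: J_def)
  also have "\<dots> \<le> integral {0..t} (\<lambda>s. c)"
  proof (rule integral_le)
    show "(\<lambda>s. \<Sum>i\<in>J. f i s) integrable_on {0..t}"
      using J by (intro integrable_sum) (auto simp: J_def)
    show "(\<Sum>i\<in>J. f i s) \<le> c" if "s \<in> {0..t}" for s
      using sum_mono2[OF assms(1) J(2), of "\<lambda>i. f i s"] nonneg[OF _ that] bound[OF that] by auto
  qed auto
  also have "\<dots> = c * t" using assms(2) by simp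
  finally show ?thesis .
qed

text \<open>
  The workload balance at a fixed time and for one sample point: \<open>A\<close> are the arrivals, \<open>D\<close> the
  departures, \<open>B\<close> the busy times, \<open>X\<close> the customers in the system, \<open>Y\<close> those in queue and \<open>P\<close>
  those in service.  Multiplying departures by prices turns the service rate \<open>mu i j\<close> into at most
  \<open>z j / nu j\<close>, the value of an hour of one server, for every class \<open>i\<close>; this is what removes the
  policy from the estimate.  The assumption \<open>small\<close> collects the errors that arise from the
  arrivals, the departures and the numbers of servers, in this order.
\<close>

lemma queue_lower_bound:
  fixes a lam lam' :: "'i::finite \<Rightarrow> real" and z nu :: "'j::finite \<Rightarrow> real"
    and mu :: "'i \<Rightarrow> 'j \<Rightarrow> real" and n t e :: real
  assumes a: "\<And>i. 0 < a i" and z: "\<And>j. 0 \<le> z j" and nu: "\<And>j. 0 < nu j"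
    and price: "\<And>i j. a i * (nu j * mu i j) \<le> z j"
    and dual: "(\<Sum>j\<in>UNIV. z j) = (\<Sum>i\<in>UNIV. a i * lam i)"
    and n: "0 \<le> n" and t: "0 \<le> t" and e: "e \<le> 1"
    and small: "e * ((\<Sum>i\<in>UNIV. a i) + real CARD('j) * (\<Sum>i\<in>UNIV. a i) + t * (\<Sum>j\<in>UNIV. z j / nu j)) \<le> 1"
    and arr: "\<And>i. (lam' i * t - e) * n \<le> A i"
    and dep: "\<And>i j. D i j \<le> mu i j * B i j + e * n"
    and busy: "\<And>i j. 0 \<le> B i j" "\<And>j. (\<Sum>i\<in>UNIV. B i j) \<le> N j * t"
    and servers: "\<And>j. N j \<le> (nu j + e) * n"
    and X: "\<And>i. 0 \<le> X i" "\<And>i. A i - (\<Sum>j\<in>UNIV. D i j) \<le> X i"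
    and Y: "\<And>i. X i - (\<Sum>j\<in>UNIV. P i j) \<le> Y i" and P: "\<And>j. (\<Sum>i\<in>UNIV. P i j) \<le> N j"
  defines "abar \<equiv> \<Sum>i\<in>UNIV. a i"
  shows "(- (1 / abar + (\<Sum>j\<in>UNIV. nu j + 1)) + (\<Sum>i\<in>UNIV. a i * (lam' i - lam i)) / abar * t) * n
    \<le> (\<Sum>i\<in>UNIV. Y i)"
proof -
  define g where "g = (\<Sum>i\<in>UNIV. a i * (lam' i - lam i))"
  define c where "c = (\<Sum>j\<in>UNIV. z j / nu j)"
  have abar: "0 < abar" unfolding abar_def by (intro sum_pos a) auto
  have work_served: "(\<Sum>i\<in>UNIV. \<Sum>j\<in>UNIV. a i * D i j)
      \<le> ((\<Sum>j\<in>UNIV. z j) + e * c) * t * n + real CARD('j) * abar * e * n"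
  proof -
    have "a i * D i j \<le> z j / nu j * B i j + a i * e * n" for i j
    proof -
      have "a i * D i j \<le> a i * (mu i j * B i j + e * n)"
        using dep a[of i] by (intro mult_left_mono) auto
      also have "\<dots> = (a i * mu i j) * B i j + a i * e * n" by (simp add: algebra_simps)
      also have "\<dots> \<le> z j / nu j * B i j + a i * e * n"
        using price[of i j] nu[of j] busy(1)
        by (intro add_right_mono mult_right_mono) (auto simp: pos_le_divide_eq mult_ac)
      finally show ?thesis .
    qed
    then have "(\<Sum>i\<in>UNIV. \<Sum>j\<in>UNIV. a i * D i j)
        \<le> (\<Sum>i\<in>UNIV. \<Sum>j\<in>UNIV. z j / nu j * B i j + a i * e * n)"
      by (intro sum_mono)
    also have "\<dots> = (\<Sum>j\<in>UNIV. z j / nu j * (\<Sum>i\<in>UNIV. B i j)) + real CARD('j) * abar * e * n"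
    proof -
      have "(\<Sum>i\<in>UNIV. \<Sum>j\<in>UNIV. z j / nu j * B i j) = (\<Sum>j\<in>UNIV. z j / nu j * (\<Sum>i\<in>UNIV. B i j))"
        unfolding sum_distrib_left by (rule sum.swap)
      moreover have "(\<Sum>i\<in>UNIV. \<Sum>j\<in>(UNIV :: 'j set). a i * e * n) = real CARD('j) * abar * e * n"
        by (simp add: abar_def sum_distrib_left sum_distrib_right mult_ac)
      ultimately show ?thesis by (simp add: sum.distrib)
    qed
    also have "(\<Sum>j\<in>UNIV. z j / nu j * (\<Sum>i\<in>UNIV. B i j))
        \<le> (\<Sum>j\<in>UNIV. z j / nu j * (((nu j + e) * n) * t))"
    proof (intro sum_mono mult_left_mono)
      fix j
      show "(\<Sum>i\<in>UNIV. B i j) \<le> (nu j + e) * n * t"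
        using busy(2)[of j] mult_right_mono[OF servers[of j] t] by linarith
      show "0 \<le> z j / nu j" using z[of j] nu[of j] by simp
    qed
    also have "\<dots> = (\<Sum>j\<in>UNIV. (z j + e * (z j / nu j)) * t * n)"
    proof (intro sum.cong refl)
      fix j
      show "z j / nu j * (((nu j + e) * n) * t) = (z j + e * (z j / nu j)) * t * n"
        using nu[of j] by (simp add: field_simps)
    qed
    also have "\<dots> = ((\<Sum>j\<in>UNIV. z j) + e * c) * t * n"
      by (simp add: c_def sum_distrib_left sum_distrib_right sum.distrib distrib_right)
    finally show ?thesis by simp
  qed
  have "(g * t - 1) * n \<le> (g * t - e * (abar + real CARD('j) * abar + t * c)) * n"
    using small n by (intro mult_right_mono) (auto simp: abar_def c_def)
  also have "\<dots> = (\<Sum>i\<in>UNIV. a i * ((lam' i * t - e) * n))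
      - (((\<Sum>j\<in>UNIV. z j) + e * c) * t * n + real CARD('j) * abar * e * n)"
  proof -
    have inflow: "(\<Sum>i\<in>UNIV. a i * ((lam' i * t - e) * n)) = (\<Sum>i\<in>UNIV. a i * lam' i) * t * n - abar * e * n"
      by (simp add: abar_def sum_distrib_left sum_distrib_right sum_subtractf algebra_simps)
    have gain: "g = (\<Sum>i\<in>UNIV. a i * lam' i) - (\<Sum>i\<in>UNIV. a i * lam i)"
      by (simp add: g_def sum_subtractf algebra_simps)
    show ?thesis unfolding dual inflow gain by (simp add: algebra_simps)
  qed
  also have "\<dots> \<le> (\<Sum>i\<in>UNIV. a i * A i) - (\<Sum>i\<in>UNIV. \<Sum>j\<in>UNIV. a i * D i j)"
    using arr a work_served by (intro diff_mono sum_mono mult_left_mono) (auto intro: less_imp_le)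
  also have "\<dots> = (\<Sum>i\<in>UNIV. a i * (A i - (\<Sum>j\<in>UNIV. D i j)))"
    by (simp add: sum_subtractf sum_distrib_left right_diff_distrib)
  also have "\<dots> \<le> (\<Sum>i\<in>UNIV. abar * X i)"
  proof (intro sum_mono)
    fix i
    have "a i \<le> abar"
      unfolding abar_def using a by (intro member_le_sum) (auto intro: less_imp_le)
    then have "a i * X i \<le> abar * X i" using X(1) by (intro mult_right_mono)
    moreover have "a i * (A i - (\<Sum>j\<in>UNIV. D i j)) \<le> a i * X i"
      using X(2) a[of i] by (intro mult_left_mono) auto
    ultimately show "a i * (A i - (\<Sum>j\<in>UNIV. D i j)) \<le> abar * X i" by linarith
  qed
  also have "\<dots> = abar * (\<Sum>i\<in>UNIV. X i)" by (simp add: sum_distrib_left)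
  finally have "(g * t - 1) * n / abar \<le> (\<Sum>i\<in>UNIV. X i)"
    using abar by (simp add: pos_divide_le_eq mult.commute)
  moreover have "(\<Sum>i\<in>UNIV. X i) - (\<Sum>j\<in>UNIV. N j) \<le> (\<Sum>i\<in>UNIV. Y i)"
  proof -
    have "(\<Sum>i\<in>UNIV. \<Sum>j\<in>UNIV. P i j) \<le> (\<Sum>j\<in>UNIV. N j)"
      using P by (subst sum.swap) (intro sum_mono)
    moreover have "(\<Sum>i\<in>UNIV. X i - (\<Sum>j\<in>UNIV. P i j)) \<le> (\<Sum>i\<in>UNIV. Y i)"
      using Y by (intro sum_mono)
    ultimately show ?thesis by (simp add: sum_subtractf)
  qed
  moreover have "(\<Sum>j\<in>UNIV. N j) \<le> (\<Sum>j\<in>UNIV. nu j + 1) * n"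
  proof -
    have "N j \<le> (nu j + 1) * n" for j
      using servers[of j] mult_right_mono[OF e n] by (simp add: distrib_right)
    then show ?thesis by (simp only: sum_distrib_right sum_mono)
  qed
  moreover have "(- (1 / abar + (\<Sum>j\<in>UNIV. nu j + 1)) + g / abar * t) * n
      = (g * t - 1) * n / abar - (\<Sum>j\<in>UNIV. nu j + 1) * n"
    using abar by (simp add: field_simps)
  ultimately show ?thesis unfolding g_def by linarith
qed

theorem proposition2p1:
  fixes lam lam' :: "'i::finite \<Rightarrow> real"
    and mubar xi :: "'i \<Rightarrow> 'j::finite \<Rightarrow> real"
    and rho :: real
  assumes "CARD('i) \<ge> 2" and "CARD('j) \<ge> 2"
    and "\<And>i. 0 < lam i"
    and "\<And>i j. 0 \<le> mubar i j"
    and "heavy_traffic lam mubar xi rho"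
    and "complete_resource_pooling mubar xi"
    and "\<And>i. lam i \<le> lam' i"
    and "\<exists>i. lam i < lam' i"
  shows "\<exists>C2>0. \<forall>nu mu. (\<forall>j. 0 < nu j) \<longrightarrow> (\<forall>i j. mubar i j = nu j * mu i j) \<longrightarrow>
    (\<exists>C1. \<forall>(M :: 'w measure) lamN muN NN lamN' X0 U S X Y Z Psi.
       prob_space M \<longrightarrow> complete_measure M \<longrightarrow>
       parameter_limits lam mu nu lamN muN NN \<longrightarrow>
       overload_limits lam' lamN' \<longrightarrow>
       initial_limits xi nu X0 \<longrightarrow>
       controlled_overloaded_model M lamN' muN NN X0 U S X Y Z Psi \<longrightarrow>
       (\<forall>t\<ge>0. (\<lambda>n. measure M {\<omega> \<in> space M.
             real (\<Sum>i\<in>UNIV. Y n i t \<omega>) \<ge> (- C1 + C2 * t) * real n}) \<longlonglongrightarrow> 1))"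
proof -
  obtain a :: "'i \<Rightarrow> real" and z :: "'j \<Rightarrow> real" where a: "\<And>i. 0 < a i"
    and price: "\<And>i j. a i * mubar i j \<le> z j"
    and dual: "(\<Sum>j\<in>UNIV. z j) = (\<Sum>i\<in>UNIV. a i * lam i)"
    using workload_prices_positive[OF assms(5,6)] by blast
  have z: "0 \<le> z j" for j
  proof -
    have "0 \<le> a undefined * mubar undefined j" using a assms(4) by (simp add: less_imp_le)
    then show ?thesis using price[of undefined j] by simp
  qed
  define abar where "abar = (\<Sum>i\<in>UNIV. a i)"
  have abar: "0 < abar" unfolding abar_def by (intro sum_pos a) auto
  define g where "g = (\<Sum>i\<in>UNIV. a i * (lam' i - lam i))"
  have "0 < g"
  proof -
    obtain i where "lam i < lam' i" using assms(8) by blast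
    then show ?thesis
      unfolding g_def using a assms(7)
      by (intro sum_pos2[where i = i]) (simp_all add: less_imp_le)
  qed
  show ?thesis
  proof (rule exI[of _ "g / abar"], intro conjI allI impI)
    show "0 < g / abar" using \<open>0 < g\<close> abar by simp
    fix nu :: "'j \<Rightarrow> real" and mu :: "'i \<Rightarrow> 'j \<Rightarrow> real"
    assume nu: "\<forall>j. 0 < nu j" and mubar: "\<forall>i j. mubar i j = nu j * mu i j"
    show "\<exists>C1. \<forall>(M :: 'w measure) lamN muN NN lamN' X0 U S X Y Z Psi.
       prob_space M \<longrightarrow> complete_measure M \<longrightarrow>
       parameter_limits lam mu nu lamN muN NN \<longrightarrow>
       overload_limits lam' lamN' \<longrightarrow>
       initial_limits xi nu X0 \<longrightarrow>
       controlled_overloaded_model M lamN' muN NN X0 U S X Y Z Psi \<longrightarrow>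
       (\<forall>t\<ge>0. (\<lambda>n. measure M {\<omega> \<in> space M.
             real (\<Sum>i\<in>UNIV. Y n i t \<omega>) \<ge> (- C1 + g / abar * t) * real n}) \<longlonglongrightarrow> 1)"
    proof (intro exI[of _ "1 / abar + (\<Sum>j\<in>UNIV. nu j + 1)"] allI impI)
      fix M :: "'w measure" and lamN muN NN lamN' X0 U S X Y Z Psi and t :: real
      assume "prob_space M" and par: "parameter_limits lam mu nu lamN muN NN"
        and over: "overload_limits lam' lamN'"
        and model: "controlled_overloaded_model M lamN' muN NN X0 U S X Y Z Psi"
        and t: "0 \<le> t"
      interpret prob_space M by fact
      let ?B = "\<lambda>n i j \<omega>. busy_time (Psi n) i j t \<omega>"
      define Q where "Q = abar + real CARD('j) * abar + t * (\<Sum>j\<in>UNIV. z j / nu j)"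
      have "0 \<le> z j / nu j" for j using z[of j] nu by (simp add: less_imp_le)
      then have Q: "0 < Q"
        unfolding Q_def using abar t
        by (intro add_pos_nonneg mult_nonneg_nonneg sum_nonneg) auto
      \<comment> \<open>With this tolerance the total error in the workload is at most \<open>n\<close>.\<close>
      define e where "e = min 1 (1 / Q)"
      have e: "0 < e" "e \<le> 1" "e * Q \<le> 1"
        using Q by (auto simp: e_def min_def field_simps)
      have U: "interarrival_sequences M U"
        using model by (simp add: controlled_overloaded_model_def)
      have queue: "queueing_model M (muN n) (NN n) (X0 n) (arrivals U (lamN' n)) (S n) (X n) (Y n) (Z n) (Psi n)"
        and prim: "primitive_processes M (muN n) (arrivals U (lamN' n)) (S n)" if "0 < n" for n
        using model that by (auto simp: controlled_overloaded_model_def Let_def)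
      have arr: "whp M (\<lambda>n \<omega>. \<forall>i\<in>UNIV. (lam' i * t - e) * real n \<le> real (arrivals U (lamN' n) i t \<omega>))"
        using over e(1) by (intro whp_ball_finite arrivals_lower_bound[OF U]) (auto simp: overload_limits_def)
      have serv: "whp M (\<lambda>n \<omega>. \<forall>p\<in>UNIV. case p of (i, j) \<Rightarrow>
          \<forall>s\<in>{0..((nu j + 1) * t) * real n}. real (S n i j s \<omega>) \<le> mu i j * s + e * real n)"
      proof (rule whp_ball_finite, goal_cases)
        case (2 p)
        obtain i j where p: "p = (i, j)" by (cases p)
        have "whp M (\<lambda>n \<omega>. \<forall>s\<in>{0..((nu j + 1) * t) * real n}. real (S n i j s \<omega>) \<le> mu i j * s + e * real n)"
          using par prim e(1)
          by (intro service_process_bound_uniform[where r = "\<lambda>n. muN n i j"])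
             (auto simp: parameter_limits_def primitive_processes_def)
        then show ?case by (simp add: p)
      qed simp
      have servers: "\<forall>\<^sub>F n in sequentially. \<forall>j. real (NN n j) \<le> (nu j + e) * real n"
      proof -
        have "\<forall>\<^sub>F n in sequentially. real (NN n j) \<le> (nu j + e) * real n" for j
        proof -
          have "(\<lambda>n. real (NN n j) / real n) \<longlonglongrightarrow> nu j"
            using par by (simp add: parameter_limits_def)
          then have "\<forall>\<^sub>F n in sequentially. real (NN n j) / real n < nu j + e"
            by (rule order_tendstoD) (use e in simp)
          then show ?thesis
            using eventually_gt_at_top[of 0]
            by eventually_elim (simp add: pos_divide_less_eq)
        qed
        then show ?thesis by (simp add: eventually_all_finite)
      qed
      have "whp M (\<lambda>n \<omega>. (- (1 / abar + (\<Sum>j\<in>UNIV. nu j + 1)) + g / abar * t) * real n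
          \<le> real (\<Sum>i\<in>UNIV. Y n i t \<omega>))"
        using whp_conj[OF arr serv]
      proof (rule whp_mono)
        show "\<forall>\<^sub>F n in sequentially. AE \<omega> in M.
            (\<forall>i\<in>UNIV. (lam' i * t - e) * real n \<le> real (arrivals U (lamN' n) i t \<omega>)) \<and>
            (\<forall>p\<in>UNIV. case p of (i, j) \<Rightarrow>
              \<forall>s\<in>{0..((nu j + 1) * t) * real n}. real (S n i j s \<omega>) \<le> mu i j * s + e * real n) \<longrightarrow>
            (- (1 / abar + (\<Sum>j\<in>UNIV. nu j + 1)) + g / abar * t) * real n \<le> real (\<Sum>i\<in>UNIV. Y n i t \<omega>)"
          using servers eventually_gt_at_top[of 0]
        proof eventually_elim
          case (elim n)
          have "AE \<omega> in M. \<forall>t\<ge>0. \<forall>i j.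
              real (X n i t \<omega>) = real (X0 n i) + real (arrivals U (lamN' n) i t \<omega>)
                - (\<Sum>j\<in>UNIV. real (S n i j (busy_time (Psi n) i j t \<omega>) \<omega>)) \<and>
              Y n i t \<omega> + (\<Sum>j\<in>UNIV. Psi n i j t \<omega>) = X n i t \<omega> \<and>
              Z n j t \<omega> + (\<Sum>i\<in>UNIV. Psi n i j t \<omega>) = NN n j"
            using queue[OF elim(2)] by (auto simp: queueing_model_def elim: eventually_mono)
          then show ?case
          proof (eventually_elim, intro impI, elim conjE)
            fix \<omega>
            assume eqs: "\<forall>t\<ge>0. \<forall>i j.
                real (X n i t \<omega>) = real (X0 n i) + real (arrivals U (lamN' n) i t \<omega>)
                  - (\<Sum>j\<in>UNIV. real (S n i j (busy_time (Psi n) i j t \<omega>) \<omega>)) \<and>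
                Y n i t \<omega> + (\<Sum>j\<in>UNIV. Psi n i j t \<omega>) = X n i t \<omega> \<and>
                Z n j t \<omega> + (\<Sum>i\<in>UNIV. Psi n i j t \<omega>) = NN n j"
              and arr: "\<forall>i\<in>UNIV. (lam' i * t - e) * real n \<le> real (arrivals U (lamN' n) i t \<omega>)"
              and serv: "\<forall>p\<in>UNIV. case p of (i, j) \<Rightarrow>
                \<forall>s\<in>{0..((nu j + 1) * t) * real n}. real (S n i j s \<omega>) \<le> mu i j * s + e * real n"
            have Psi_N: "(\<Sum>i\<in>UNIV. real (Psi n i j s \<omega>)) \<le> real (NN n j)" if "0 \<le> s" for j s
            proof -
              have "(\<Sum>i\<in>UNIV. Psi n i j s \<omega>) \<le> NN n j" using eqs that by (metis le_add2)
              then show ?thesis by (simp flip: of_nat_sum)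
            qed
            have B0: "0 \<le> ?B n i j \<omega>" for i j
              unfolding busy_time_def
              by (cases "(\<lambda>s. real (Psi n i j s \<omega>)) integrable_on {0..t}")
                 (auto intro: Henstock_Kurzweil_Integration.integral_nonneg simp: not_integrable_integral)
            have B_col: "(\<Sum>i\<in>UNIV. ?B n i j \<omega>) \<le> real (NN n j) * t" for j
              unfolding busy_time_def using t Psi_N by (intro sum_integral_le) auto
            \<comment> \<open>The busy times stay in the interval on which the service processes are controlled.\<close>
            have B_le: "?B n i j \<omega> \<le> ((nu j + 1) * t) * real n" for i j
            proof -
              have "?B n i j \<omega> \<le> (\<Sum>i\<in>UNIV. ?B n i j \<omega>)"
                using B0 by (intro member_le_sum) auto
              also have "\<dots> \<le> real (NN n j) * t" by (rule B_col)
              also have "\<dots> \<le> ((nu j + e) * real n) * t"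
                using elim(1) t by (intro mult_right_mono) auto
              also have "\<dots> \<le> ((nu j + 1) * real n) * t"
                using e t by (intro mult_right_mono) auto
              finally show ?thesis by (simp add: mult_ac)
            qed
            have "(- (1 / abar + (\<Sum>j\<in>UNIV. nu j + 1)) + g / abar * t) * real n
                \<le> (\<Sum>i\<in>UNIV. real (Y n i t \<omega>))"
              unfolding abar_def g_def
            proof (rule queue_lower_bound[where mu = mu and e = e and z = z
                  and A = "\<lambda>i. real (arrivals U (lamN' n) i t \<omega>)"
                  and D = "\<lambda>i j. real (S n i j (?B n i j \<omega>) \<omega>)"
                  and B = "\<lambda>i j. ?B n i j \<omega>" and N = "\<lambda>j. real (NN n j)"
                  and X = "\<lambda>i. real (X n i t \<omega>)" and P = "\<lambda>i j. real (Psi n i j t \<omega>)"])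
              show "a i * (nu j * mu i j) \<le> z j" for i j
                using price mubar by simp
              show "e * ((\<Sum>i\<in>UNIV. a i) + real CARD('j) * (\<Sum>i\<in>UNIV. a i)
                  + t * (\<Sum>j\<in>UNIV. z j / nu j)) \<le> 1"
                using e(3) by (simp add: Q_def abar_def)
              show "real (S n i j (?B n i j \<omega>) \<omega>) \<le> mu i j * ?B n i j \<omega> + e * real n" for i j
                using serv B0 B_le by auto
              show "real (arrivals U (lamN' n) i t \<omega>)
                  - (\<Sum>j\<in>UNIV. real (S n i j (?B n i j \<omega>) \<omega>)) \<le> real (X n i t \<omega>)" for i
                using eqs t by simp
              show "real (X n i t \<omega>) - (\<Sum>j\<in>UNIV. real (Psi n i j t \<omega>)) \<le> real (Y n i t \<omega>)" for i
              proof -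
                have "X n i t \<omega> = Y n i t \<omega> + (\<Sum>j\<in>UNIV. Psi n i j t \<omega>)" using eqs t by metis
                then show ?thesis by simp
              qed
            qed (use a z nu dual t e arr elim B0 B_col Psi_N in auto)
            then show "(- (1 / abar + (\<Sum>j\<in>UNIV. nu j + 1)) + g / abar * t) * real n
                \<le> real (\<Sum>i\<in>UNIV. Y n i t \<omega>)" by simp
          qed
        qed
      qed
      moreover have "\<forall>\<^sub>F n in sequentially. {\<omega> \<in> space M.
          (- (1 / abar + (\<Sum>j\<in>UNIV. nu j + 1)) + g / abar * t) * real n
            \<le> real (\<Sum>i\<in>UNIV. Y n i t \<omega>)} \<in> sets M"
        using eventually_gt_at_top[of 0]
      proof eventually_elim
        case (elim n)
        have [measurable]: "Y n i t \<in> M \<rightarrow>\<^sub>M count_space UNIV" for i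
          using queue[OF elim] t by (simp add: queueing_model_def)
        show ?case unfolding of_nat_sum by measurable
      qed
      ultimately show "(\<lambda>n. measure M {\<omega> \<in> space M. real (\<Sum>i\<in>UNIV. Y n i t \<omega>) \<ge>
          (- (1 / abar + (\<Sum>j\<in>UNIV. nu j + 1)) + g / abar * t) * real n}) \<longlonglongrightarrow> 1"
        by (rule whp_prob_tendsto_1)
    qed
  qed
qed

end
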